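(* Let $\mathcal{D}=\langle\mathcal{A},\mathcal{B}\rangle$ be a triangulated category with a semiorthogonal decomposition, and let $\sigma_{\mathcal{A}}=(\mathcal{A}_0,Z_{\mathcal{A}})$ and $\sigma_{\mathcal{B}}=(\mathcal{B}_0,Z_{\mathcal{B}})$ be stability conditions on the components such that the $t$-structures glue, with heart $\mathrm{gl}(\mathcal{A}_0,\mathcal{B}_0)=\mathcal{A}_0\times_{M_0}\mathcal{B}_0$. Assume that $\sigma_{\mathrm{gl}}=(\mathrm{gl}(\mathcal{A}_0,\mathcal{B}_0),Z_{\mathcal{A}}+Z_{\mathcal{B}})$ is a pre-stability condition and that there exists a real number $\epsilon\in(0,1)$ such that for every $\sigma_{\mathrm{gl}}$-semistable object $E=(A,B,\mu)\in\mathrm{gl}(\mathcal{A}_0,\mathcal{B}_0)$ with $A\ne0$, $B\neq0$ and $\mu\ne0$ we have $$\phi_{\mathcal{A}}^{+}(A)-\phi_{\mathcal{B}}^{-}(B)\le 1-\epsilon .$$ Then $\sigma_{\mathrm{gl}}$ is a stability condition on $\mathcal{D}$.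
   Context: Semiorthogonal decomposition $\mathcal{D}=\langle\mathcal{A},\mathcal{B}\rangle$: full triangulated subcategories with $\mathrm{Hom}_{\mathcal{D}}(\mathcal{B},\mathcal{A})=0$ and every $E\in\mathcal{D}$ in a triangle $B\to E\to A\to B[1]$, $A\in\mathcal{A}$, $B\in\mathcal{B}$; $i_{\mathcal{A}}^*$ is the left adjoint of $\mathcal{A}\hookrightarrow\mathcal{D}$ and $i_{\mathcal{B}}^!$ the right adjoint of $\mathcal{B}\hookrightarrow\mathcal{D}$. A pre-stability condition on a triangulated category $\mathcal{T}$ is a locally finite stability condition in Bridgeland's original sense, written as a pair $(\mathcal{H},Z)$: $\mathcal{H}$ the heart of a bounded $t$-structure, $Z\colon K_0(\mathcal{T})\to\mathbb{C}$ a homomorphism which is a stability function on $\mathcal{H}$ (values on nonzero objects of $\mathcal{H}$ in $\{re^{i\pi\phi}:r>0,\phi\in(0,1]\}$) with the Harder–Narasimhan property. A stability condition is a pre-stability condition satisfying the support property: there are a finite-rank free abelian group $\Lambda$, a factorization $Z\colon K_0(\mathcal{T})\xrightarrow{u}\Lambda\to\mathbb{C}$, a norm on $\Lambda\otimes\mathbb{R}$ and $C>0$ with $\|u([E])\|\le C|Z(E)|$ for all semistable $E$. $\phi^+(E),\phi^-(E)$ denote the maximal and minimal phases of the Harder–Narasimhan factors of a nonzero object $E$ (subscript indicating the stability condition $\sigma_{\mathcal{A}}$ or $\sigma_{\mathcal{B}}$). The $t$-structures glue means $\mathrm{Hom}_{\mathcal{D}}(A,B[i])=0$ for all $A\in\mathcal{A}_0$,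 $B\in\mathcal{B}_0$, $i\le0$; then the extension closure $\mathrm{gl}(\mathcal{A}_0,\mathcal{B}_0)$ of $\mathcal{A}_0$ and $\mathcal{B}_0$ is the heart of a bounded $t$-structure on $\mathcal{D}$. Its objects $E$ are identified with triples $(A,B,\mu)$, where $A=i_{\mathcal{A}}^*E\in\mathcal{A}_0$, $B=i_{\mathcal{B}}^!E\in\mathcal{B}_0$, and $\mu\in M_0(A,B)=\mathrm{Ext}^1_{\mathrm{gl}(\mathcal{A}_0,\mathcal{B}_0)}(A,B)\cong\mathrm{Hom}_{\mathcal{D}}(A,B[1])$ is the class of the extension $0\to B\to E\to A\to0$; this identifies $\mathrm{gl}(\mathcal{A}_0,\mathcal{B}_0)$ with the category $\mathcal{A}_0\times_{M_0}\mathcal{B}_0$ of such triples, where morphisms $(A,B,\mu)\to(A',B',\mu')$ are pairs $(f\colon A\to A',g\colon B\to B')$ with $M_0(\mathrm{id}_A,g)(\mu)=M_0(f,\mathrm{id}_{B'})(\mu')$. The central charge $Z_{\mathcal{A}}+Z_{\mathcal{B}}$ means $E\mapsto Z_{\mathcal{A}}(i_{\mathcal{A}}^*E)+Z_{\mathcal{B}}(i_{\mathcal{B}}^!E)$. *)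

theory Defs
  imports Complex_Main "HOL-Algebra.Free_Abelian_Groups"
begin

section \<open>Triangulated categories\<close>

text \<open>The objects are all elements of \<^typ>\<open>'o\<close>; nothing is lost, since a triangulated category has
  at least a zero object.  \<open>Comp C g f\<close> is ``g after f''; \<open>Shift C n\<close> and \<open>ShiftM C n\<close> are the
  n-th power of the translation functor on objects and morphisms.\<close>

record ('o, 'm) tricat =
  Mor :: "'o \<Rightarrow> 'o \<Rightarrow> 'm set"
  Comp :: "'m \<Rightarrow> 'm \<Rightarrow> 'm"
  Ident :: "'o \<Rightarrow> 'm"
  Plus :: "'m \<Rightarrow> 'm \<Rightarrow> 'm"
  Null :: "'o \<Rightarrow> 'o \<Rightarrow> 'm"
  Shift :: "int \<Rightarrow> 'o \<Rightarrow> 'o"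
  ShiftM :: "int \<Rightarrow> 'm \<Rightarrow> 'm"
  Tri :: "('m \<times> 'm \<times> 'm) set"

definition mor_group :: "('o, 'm) tricat \<Rightarrow> 'o \<Rightarrow> 'o \<Rightarrow> 'm monoid" where
  "mor_group C X Y = \<lparr>carrier = Mor C X Y, mult = Plus C, one = Null C X Y\<rparr>"

definition Minus :: "('o, 'm) tricat \<Rightarrow> 'o \<Rightarrow> 'o \<Rightarrow> 'm \<Rightarrow> 'm" where
  "Minus C X Y f = inv\<^bsub>mor_group C X Y\<^esub> f"

definition mutually_inverse :: "('o, 'm) tricat \<Rightarrow> 'o \<Rightarrow> 'o \<Rightarrow> 'm \<Rightarrow> 'm \<Rightarrow> bool" where
  "mutually_inverse C X Y f g \<longleftrightarrow> f \<in> Mor C X Y \<and> g \<in> Mor C Y X \<and>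
     Comp C g f = Ident C X \<and> Comp C f g = Ident C Y"

definition isomorphism :: "('o, 'm) tricat \<Rightarrow> 'o \<Rightarrow> 'o \<Rightarrow> 'm \<Rightarrow> bool" where
  "isomorphism C X Y f \<longleftrightarrow> (\<exists>g. mutually_inverse C X Y f g)"

definition isomorphic :: "('o, 'm) tricat \<Rightarrow> 'o \<Rightarrow> 'o \<Rightarrow> bool" where
  "isomorphic C X Y \<longleftrightarrow> (\<exists>f. isomorphism C X Y f)"

definition zero_object :: "('o, 'm) tricat \<Rightarrow> 'o \<Rightarrow> bool" where
  "zero_object C X \<longleftrightarrow> (\<forall>Y. (\<exists>!f. f \<in> Mor C X Y) \<and> (\<exists>!f. f \<in> Mor C Y X))"

definition biproduct ::
    "('o, 'm) tricat \<Rightarrow> 'o \<Rightarrow> 'o \<Rightarrow> 'o \<Rightarrow> 'm \<Rightarrow> 'm \<Rightarrow> 'm \<Rightarrow> 'm \<Rightarrow> bool" where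
  "biproduct C X Y P i j p q \<longleftrightarrow>
     i \<in> Mor C X P \<and> j \<in> Mor C Y P \<and> p \<in> Mor C P X \<and> q \<in> Mor C P Y \<and>
     Comp C p i = Ident C X \<and> Comp C q j = Ident C Y \<and>
     Comp C q i = Null C X Y \<and> Comp C p j = Null C Y X \<and>
     Plus C (Comp C i p) (Comp C j q) = Ident C P"

text \<open>\<open>distinguished C X Y Z f g h\<close>: the diagram X \<open>\<rightarrow>\<close> Y \<open>\<rightarrow>\<close> Z \<open>\<rightarrow>\<close> X[1] with arrows f, g, h is a
  distinguished triangle.\<close>

definition distinguished ::
    "('o, 'm) tricat \<Rightarrow> 'o \<Rightarrow> 'o \<Rightarrow> 'o \<Rightarrow> 'm \<Rightarrow> 'm \<Rightarrow> 'm \<Rightarrow> bool" where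
  "distinguished C X Y Z f g h \<longleftrightarrow>
     f \<in> Mor C X Y \<and> g \<in> Mor C Y Z \<and> h \<in> Mor C Z (Shift C 1 X) \<and> (f, g, h) \<in> Tri C"

locale category =
  fixes C :: "('o, 'm) tricat"
  assumes mor_unique:
      "\<lbrakk>f \<in> Mor C X Y; f \<in> Mor C X' Y'\<rbrakk> \<Longrightarrow> X = X' \<and> Y = Y'"
    and ident_mor: "Ident C X \<in> Mor C X X"
    and comp_mor: "\<lbrakk>f \<in> Mor C X Y; g \<in> Mor C Y Z\<rbrakk> \<Longrightarrow> Comp C g f \<in> Mor C X Z"
    and comp_ident: "f \<in> Mor C X Y \<Longrightarrow> Comp C f (Ident C X) = f"
    and ident_comp: "f \<in> Mor C X Y \<Longrightarrow> Comp C (Ident C Y) f = f"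
    and comp_assoc: "\<lbrakk>f \<in> Mor C W X; g \<in> Mor C X Y; h \<in> Mor C Y Z\<rbrakk> \<Longrightarrow>
      Comp C h (Comp C g f) = Comp C (Comp C h g) f"

locale additive_category = category +
  assumes mor_comm_group: "comm_group (mor_group C X Y)"
    and comp_plus_right: "\<lbrakk>f \<in> Mor C X Y; f' \<in> Mor C X Y; g \<in> Mor C Y Z\<rbrakk> \<Longrightarrow>
      Comp C g (Plus C f f') = Plus C (Comp C g f) (Comp C g f')"
    and comp_plus_left: "\<lbrakk>f \<in> Mor C X Y; g \<in> Mor C Y Z; g' \<in> Mor C Y Z\<rbrakk> \<Longrightarrow>
      Comp C (Plus C g g') f = Plus C (Comp C g f) (Comp C g' f)"
    and ex_zero_object: "\<exists>X. zero_object C X"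
    and ex_biproduct: "\<exists>P i j p q. biproduct C X Y P i j p q"

locale category_with_shift = additive_category +
  assumes shift_mor: "f \<in> Mor C X Y \<Longrightarrow> ShiftM C n f \<in> Mor C (Shift C n X) (Shift C n Y)"
    and shift_ident: "ShiftM C n (Ident C X) = Ident C (Shift C n X)"
    and shift_comp: "\<lbrakk>f \<in> Mor C X Y; g \<in> Mor C Y Z\<rbrakk> \<Longrightarrow>
      ShiftM C n (Comp C g f) = Comp C (ShiftM C n g) (ShiftM C n f)"
    and shift_plus: "\<lbrakk>f \<in> Mor C X Y; g \<in> Mor C X Y\<rbrakk> \<Longrightarrow>
      ShiftM C n (Plus C f g) = Plus C (ShiftM C n f) (ShiftM C n g)"
    and shift_0: "Shift C 0 X = X"
    and shift_add: "Shift C (m + n) X = Shift C m (Shift C n X)"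
    and shiftm_0: "f \<in> Mor C X Y \<Longrightarrow> ShiftM C 0 f = f"
    and shiftm_add: "f \<in> Mor C X Y \<Longrightarrow> ShiftM C (m + n) f = ShiftM C m (ShiftM C n f)"

locale triangulated_category = category_with_shift +
  assumes tri_ident: "zero_object C Z \<Longrightarrow>
      distinguished C X X Z (Ident C X) (Null C X Z) (Null C Z (Shift C 1 X))"
    and tri_iso: "\<lbrakk>distinguished C X Y Z f g h;
        isomorphism C X X' a; isomorphism C Y Y' b; isomorphism C Z Z' c;
        f' \<in> Mor C X' Y'; g' \<in> Mor C Y' Z'; h' \<in> Mor C Z' (Shift C 1 X');
        Comp C f' a = Comp C b f; Comp C g' b = Comp C c g;
        Comp C h' c = Comp C (ShiftM C 1 a) h\<rbrakk> \<Longrightarrow>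
      distinguished C X' Y' Z' f' g' h'"
    and tri_complete: "f \<in> Mor C X Y \<Longrightarrow> \<exists>Z g h. distinguished C X Y Z f g h"
    and tri_rotate: "\<lbrakk>f \<in> Mor C X Y; g \<in> Mor C Y Z; h \<in> Mor C Z (Shift C 1 X)\<rbrakk> \<Longrightarrow>
      distinguished C X Y Z f g h \<longleftrightarrow>
      distinguished C Y Z (Shift C 1 X) g h (Minus C (Shift C 1 X) (Shift C 1 Y) (ShiftM C 1 f))"
    and tri_morphism: "\<lbrakk>distinguished C X Y Z f g h; distinguished C X' Y' Z' f' g' h';
        a \<in> Mor C X X'; b \<in> Mor C Y Y'; Comp C f' a = Comp C b f\<rbrakk> \<Longrightarrow>
      \<exists>c \<in> Mor C Z Z'. Comp C g' b = Comp C c g \<and> Comp C h' c = Comp C (ShiftM C 1 a) h"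
    and octahedral: "\<lbrakk>distinguished C X Y Q1 f p1 d1;
        distinguished C X Z Q2 (Comp C g f) p2 d2;
        distinguished C Y Z Q3 g p3 d3\<rbrakk> \<Longrightarrow>
      \<exists>a b. distinguished C Q1 Q2 Q3 a b (Comp C (ShiftM C 1 p1) d3) \<and>
        Comp C p2 g = Comp C a p1 \<and> Comp C d2 a = d1 \<and>
        Comp C b p2 = p3 \<and> Comp C d3 b = Comp C (ShiftM C 1 f) d2"


section \<open>Full subcategories\<close>

text \<open>A full subcategory is given by its set of objects.\<close>

definition replete :: "('o, 'm) tricat \<Rightarrow> 'o set \<Rightarrow> bool" where
  "replete C S \<longleftrightarrow> (\<forall>X\<in>S. \<forall>Y. isomorphic C X Y \<longrightarrow> Y \<in> S)"

definition triangulated_subcategory :: "('o, 'm) tricat \<Rightarrow> 'o set \<Rightarrow> bool" where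
  "triangulated_subcategory C S \<longleftrightarrow>
     replete C S \<and> (\<forall>X. zero_object C X \<longrightarrow> X \<in> S) \<and>
     (\<forall>X\<in>S. \<forall>n. Shift C n X \<in> S) \<and>
     (\<forall>X Y Z f g h. distinguished C X Y Z f g h \<longrightarrow> X \<in> S \<longrightarrow> Y \<in> S \<longrightarrow> Z \<in> S)"

inductive_set extension_closure :: "('o, 'm) tricat \<Rightarrow> 'o set \<Rightarrow> 'o set"
  for C :: "('o, 'm) tricat" and S :: "'o set" where
  base: "X \<in> S \<Longrightarrow> X \<in> extension_closure C S"
| zero: "zero_object C X \<Longrightarrow> X \<in> extension_closure C S"
| ext: "\<lbrakk>distinguished C X Y Z f g h; X \<in> extension_closure C S; Z \<in> extension_closure C S\<rbrakk> \<Longrightarrow>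
    Y \<in> extension_closure C S"

text \<open>Monomorphisms, kernels and cokernels relative to the full subcategory on S.\<close>

definition mono_in :: "('o, 'm) tricat \<Rightarrow> 'o set \<Rightarrow> 'o \<Rightarrow> 'o \<Rightarrow> 'm \<Rightarrow> bool" where
  "mono_in C S X Y i \<longleftrightarrow> X \<in> S \<and> Y \<in> S \<and> i \<in> Mor C X Y \<and>
     (\<forall>W\<in>S. \<forall>g\<in>Mor C W X. \<forall>g'\<in>Mor C W X. Comp C i g = Comp C i g' \<longrightarrow> g = g')"

definition kernel_in :: "('o, 'm) tricat \<Rightarrow> 'o set \<Rightarrow> 'o \<Rightarrow> 'o \<Rightarrow> 'o \<Rightarrow> 'm \<Rightarrow> 'm \<Rightarrow> bool" where
  "kernel_in C S K X Y k f \<longleftrightarrow> K \<in> S \<and> X \<in> S \<and> Y \<in> S \<and>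
     k \<in> Mor C K X \<and> f \<in> Mor C X Y \<and> Comp C f k = Null C K Y \<and>
     (\<forall>W\<in>S. \<forall>g\<in>Mor C W X. Comp C f g = Null C W Y \<longrightarrow> (\<exists>!v. v \<in> Mor C W K \<and> Comp C k v = g))"

definition cokernel_in :: "('o, 'm) tricat \<Rightarrow> 'o set \<Rightarrow> 'o \<Rightarrow> 'o \<Rightarrow> 'o \<Rightarrow> 'm \<Rightarrow> 'm \<Rightarrow> bool" where
  "cokernel_in C S X Y Q f q \<longleftrightarrow> X \<in> S \<and> Y \<in> S \<and> Q \<in> S \<and>
     f \<in> Mor C X Y \<and> q \<in> Mor C Y Q \<and> Comp C q f = Null C X Q \<and>
     (\<forall>W\<in>S. \<forall>g\<in>Mor C Y W. Comp C g f = Null C X W \<longrightarrow> (\<exists>!v. v \<in> Mor C Q W \<and> Comp C v q = g))"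

definition short_exact_in :: "('o, 'm) tricat \<Rightarrow> 'o set \<Rightarrow> 'o \<Rightarrow> 'o \<Rightarrow> 'o \<Rightarrow> 'm \<Rightarrow> 'm \<Rightarrow> bool" where
  "short_exact_in C S X Y Z i q \<longleftrightarrow> kernel_in C S X Y Z i q \<and> cokernel_in C S X Y Z i q"

text \<open>Finite length of a quasi-abelian category: ascending and descending chains of strict
  subobjects (those embedded by the first map of a strict short exact sequence) stabilise.\<close>

definition strict_mono_in :: "('o, 'm) tricat \<Rightarrow> 'o set \<Rightarrow> 'o \<Rightarrow> 'o \<Rightarrow> 'm \<Rightarrow> bool" where
  "strict_mono_in C S X Y i \<longleftrightarrow> (\<exists>Z q. short_exact_in C S X Y Z i q)"

definition factors_through ::
    "('o, 'm) tricat \<Rightarrow> 'o \<Rightarrow> 'm \<Rightarrow> 'o \<Rightarrow> 'm \<Rightarrow> bool" where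
  "factors_through C U i V j \<longleftrightarrow> (\<exists>k\<in>Mor C U V. Comp C j k = i)"

definition finite_length :: "('o, 'm) tricat \<Rightarrow> 'o set \<Rightarrow> bool" where
  "finite_length C S \<longleftrightarrow>
     (\<forall>X\<in>S. \<forall>U i. (\<forall>n::nat. strict_mono_in C S (U n) X (i n)) \<longrightarrow>
       ((\<forall>n. factors_through C (U n) (i n) (U (Suc n)) (i (Suc n))) \<longrightarrow>
         (\<exists>N. \<forall>n\<ge>N. factors_through C (U (Suc n)) (i (Suc n)) (U n) (i n))) \<and>
       ((\<forall>n. factors_through C (U (Suc n)) (i (Suc n)) (U n) (i n)) \<longrightarrow>
         (\<exists>N. \<forall>n\<ge>N. factors_through C (U n) (i n) (U (Suc n)) (i (Suc n)))))"


section \<open>t-structures\<close>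

text \<open>In the pair (U, V), U is \<open>T\<^bsup>\<le>0\<^esup>\<close> and V is \<open>T\<^bsup>\<ge>0\<^esup>\<close>.\<close>

definition t_structure :: "('o, 'm) tricat \<Rightarrow> 'o set \<Rightarrow> 'o set \<Rightarrow> 'o set \<Rightarrow> bool" where
  "t_structure C T U V \<longleftrightarrow>
     U \<subseteq> T \<and> V \<subseteq> T \<and> replete C U \<and> replete C V \<and>
     (\<forall>X\<in>U. Shift C 1 X \<in> U) \<and> (\<forall>Y\<in>V. Shift C (-1) Y \<in> V) \<and>
     (\<forall>X\<in>U. \<forall>Y\<in>V. Mor C X (Shift C (-1) Y) = {Null C X (Shift C (-1) Y)}) \<and>
     (\<forall>E\<in>T. \<exists>X\<in>U. \<exists>Y\<in>V. \<exists>f g h. distinguished C X E (Shift C (-1) Y) f g h)"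

definition bounded_t_structure :: "('o, 'm) tricat \<Rightarrow> 'o set \<Rightarrow> 'o set \<Rightarrow> 'o set \<Rightarrow> bool" where
  "bounded_t_structure C T U V \<longleftrightarrow> t_structure C T U V \<and>
     (\<forall>E\<in>T. \<exists>m n. Shift C m E \<in> U \<and> Shift C n E \<in> V)"

definition heart_of_bounded_t_structure :: "('o, 'm) tricat \<Rightarrow> 'o set \<Rightarrow> 'o set \<Rightarrow> bool" where
  "heart_of_bounded_t_structure C T H \<longleftrightarrow> (\<exists>U V. bounded_t_structure C T U V \<and> H = U \<inter> V)"


section \<open>Grothendieck group\<close>

definition K0_relations :: "('o, 'm) tricat \<Rightarrow> 'o set \<Rightarrow> ('o \<Rightarrow>\<^sub>0 int) set" where
  "K0_relations C T = {frag_of Y - frag_of X - frag_of Z | X Y Z f g h.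
     X \<in> T \<and> Y \<in> T \<and> Z \<in> T \<and> distinguished C X Y Z f g h}"

definition K0_subgroup :: "('o, 'm) tricat \<Rightarrow> 'o set \<Rightarrow> ('o \<Rightarrow>\<^sub>0 int) set" where
  "K0_subgroup C T = generate (free_Abelian_group T) (K0_relations C T)"

definition K0 :: "('o, 'm) tricat \<Rightarrow> 'o set \<Rightarrow> ('o \<Rightarrow>\<^sub>0 int) set monoid" where
  "K0 C T = free_Abelian_group T Mod K0_subgroup C T"

definition K0_class :: "('o, 'm) tricat \<Rightarrow> 'o set \<Rightarrow> 'o \<Rightarrow> ('o \<Rightarrow>\<^sub>0 int) set" where
  "K0_class C T E = K0_subgroup C T #>\<^bsub>free_Abelian_group T\<^esub> frag_of E"

definition complex_group :: "complex monoid" where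
  "complex_group = \<lparr>carrier = UNIV, mult = (+), one = 0\<rparr>"


section \<open>Stability conditions\<close>

text \<open>Throughout, T is a full triangulated subcategory of C (possibly all of C), H the heart of a
  bounded t-structure on T, and Z a homomorphism from \<open>K0 C T\<close> to the complex numbers.\<close>

type_synonym 'o charge = "('o \<Rightarrow>\<^sub>0 int) set \<Rightarrow> complex"

definition stability_function ::
    "('o, 'm) tricat \<Rightarrow> 'o set \<Rightarrow> 'o set \<Rightarrow> 'o charge \<Rightarrow> bool" where
  "stability_function C T H Z \<longleftrightarrow>
     (\<forall>E\<in>H. \<not> zero_object C E \<longrightarrow>
       (\<exists>r \<phi>. 0 < r \<and> 0 < \<phi> \<and> \<phi> \<le> 1 \<and> Z (K0_class C T E) = rcis r (pi * \<phi>)))"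

text \<open>\<^const>\<open>Arg\<close> takes values in \<open>]-\<pi>, \<pi>]\<close>, so for a stability function this is the phase in \<open>]0, 1]\<close>.\<close>

definition phase :: "('o, 'm) tricat \<Rightarrow> 'o set \<Rightarrow> 'o charge \<Rightarrow> 'o \<Rightarrow> real" where
  "phase C T Z E = Arg (Z (K0_class C T E)) / pi"

definition semistable ::
    "('o, 'm) tricat \<Rightarrow> 'o set \<Rightarrow> 'o set \<Rightarrow> 'o charge \<Rightarrow> 'o \<Rightarrow> bool" where
  "semistable C T H Z E \<longleftrightarrow> E \<in> H \<and> \<not> zero_object C E \<and>
     (\<forall>X i. mono_in C H X E i \<and> \<not> zero_object C X \<longrightarrow> phase C T Z X \<le> phase C T Z E)"

text \<open>A filtration 0 = E 0 \<open>\<subset>\<close> E 1 \<open>\<subset>\<close> \<open>\<dots>\<close> \<open>\<subset>\<close> E n in H with inclusions i k from E k to E (k + 1)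
  and factors F k = E (k + 1) / E k, for k < n.\<close>

definition HN_filtration ::
    "('o, 'm) tricat \<Rightarrow> 'o set \<Rightarrow> 'o set \<Rightarrow> 'o charge \<Rightarrow> 'o \<Rightarrow>
     nat \<Rightarrow> (nat \<Rightarrow> 'o) \<Rightarrow> (nat \<Rightarrow> 'o) \<Rightarrow> (nat \<Rightarrow> 'm) \<Rightarrow> (nat \<Rightarrow> 'm) \<Rightarrow> bool" where
  "HN_filtration C T H Z X n E F i q \<longleftrightarrow>
     0 < n \<and> zero_object C (E 0) \<and> E n = X \<and>
     (\<forall>k<n. short_exact_in C H (E k) (E (Suc k)) (F k) (i k) (q k) \<and>
            semistable C T H Z (F k)) \<and>
     (\<forall>k l. k < l \<and> l < n \<longrightarrow> phase C T Z (F l) < phase C T Z (F k))"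

definition HN_property ::
    "('o, 'm) tricat \<Rightarrow> 'o set \<Rightarrow> 'o set \<Rightarrow> 'o charge \<Rightarrow> bool" where
  "HN_property C T H Z \<longleftrightarrow>
     (\<forall>X\<in>H. \<not> zero_object C X \<longrightarrow> (\<exists>n E F i q. HN_filtration C T H Z X n E F i q))"

text \<open>Phases of the Harder--Narasimhan factors of a nonzero object of the heart.  The filtration is
  unique up to isomorphism, so the choice is immaterial.\<close>

definition HN_phases ::
    "('o, 'm) tricat \<Rightarrow> 'o set \<Rightarrow> 'o set \<Rightarrow> 'o charge \<Rightarrow> 'o \<Rightarrow> real set" where
  "HN_phases C T H Z X =
     (SOME S. \<exists>n E F i q. HN_filtration C T H Z X n E F i q \<and>
        S = (\<lambda>k. phase C T Z (F k)) ` {..<n})"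

definition phi_plus :: "('o, 'm) tricat \<Rightarrow> 'o set \<Rightarrow> 'o set \<Rightarrow> 'o charge \<Rightarrow> 'o \<Rightarrow> real" where
  "phi_plus C T H Z X = Max (HN_phases C T H Z X)"

definition phi_minus :: "('o, 'm) tricat \<Rightarrow> 'o set \<Rightarrow> 'o set \<Rightarrow> 'o charge \<Rightarrow> 'o \<Rightarrow> real" where
  "phi_minus C T H Z X = Min (HN_phases C T H Z X)"

text \<open>The slicing: \<open>P(\<phi>)\<close> consists of the semistable objects of H of phase \<open>\<phi>\<close> for \<open>\<phi> \<in> ]0, 1]\<close>, together
  with zero, and \<open>P(\<phi> + n) = P(\<phi>)[n]\<close>.\<close>

definition slice ::
    "('o, 'm) tricat \<Rightarrow> 'o set \<Rightarrow> 'o set \<Rightarrow> 'o charge \<Rightarrow> real \<Rightarrow> 'o set" where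
  "slice C T H Z \<phi> = {X. zero_object C X} \<union>
     {Shift C n F | F n. semistable C T H Z F \<and> phase C T Z F + of_int n = \<phi>}"

definition slice_interval ::
    "('o, 'm) tricat \<Rightarrow> 'o set \<Rightarrow> 'o set \<Rightarrow> 'o charge \<Rightarrow> real set \<Rightarrow> 'o set" where
  "slice_interval C T H Z I = extension_closure C (\<Union>\<phi>\<in>I. slice C T H Z \<phi>)"

text \<open>The bound \<open>\<eta> < 1/2\<close> is harmless and ensures that the categories \<open>P(]t - \<eta>, t + \<eta>[)\<close> are
  quasi-abelian.\<close>

definition locally_finite ::
    "('o, 'm) tricat \<Rightarrow> 'o set \<Rightarrow> 'o set \<Rightarrow> 'o charge \<Rightarrow> bool" where
  "locally_finite C T H Z \<longleftrightarrow>
     (\<exists>\<eta>. 0 < \<eta> \<and> \<eta> < 1/2 \<and>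
       (\<forall>t. finite_length C (slice_interval C T H Z {t - \<eta> <..< t + \<eta>})))"

definition prestability_condition ::
    "('o, 'm) tricat \<Rightarrow> 'o set \<Rightarrow> 'o set \<Rightarrow> 'o charge \<Rightarrow> bool" where
  "prestability_condition C T H Z \<longleftrightarrow>
     heart_of_bounded_t_structure C T H \<and> Z \<in> hom (K0 C T) complex_group \<and>
     stability_function C T H Z \<and> HN_property C T H Z \<and> locally_finite C T H Z"

text \<open>Norms on \<open>\<real>\<^sup>n\<close>, realised as the sequences vanishing from index n on.  This is
  \<open>\<Lambda> \<otimes> \<real>\<close> for the free abelian group \<open>\<Lambda>\<close> on \<open>{..<n}\<close>.\<close>

definition is_norm :: "nat \<Rightarrow> ((nat \<Rightarrow> real) \<Rightarrow> real) \<Rightarrow> bool" where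
  "is_norm n N \<longleftrightarrow>
     (\<forall>x. (\<forall>k\<ge>n. x k = 0) \<longrightarrow>
        0 \<le> N x \<and> (N x = 0 \<longleftrightarrow> x = (\<lambda>_. 0)) \<and> (\<forall>c. N (\<lambda>k. c * x k) = \<bar>c\<bar> * N x) \<and>
        (\<forall>y. (\<forall>k\<ge>n. y k = 0) \<longrightarrow> N (\<lambda>k. x k + y k) \<le> N x + N y))"

text \<open>Every free abelian group \<open>\<Lambda>\<close> of finite rank is isomorphic to the one on \<open>{..<n}\<close> for some n.\<close>

definition support_property ::
    "('o, 'm) tricat \<Rightarrow> 'o set \<Rightarrow> 'o set \<Rightarrow> 'o charge \<Rightarrow> bool" where
  "support_property C T H Z \<longleftrightarrow>
     (\<exists>(n::nat) u l N K.
        u \<in> hom (K0 C T) (free_Abelian_group {..<n}) \<and>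
        l \<in> hom (free_Abelian_group {..<n}) complex_group \<and>
        (\<forall>x \<in> carrier (K0 C T). Z x = l (u x)) \<and>
        is_norm n N \<and> 0 < K \<and>
        (\<forall>\<phi>. \<forall>E \<in> slice C T H Z \<phi>. \<not> zero_object C E \<longrightarrow>
           N (\<lambda>k. real_of_int (Poly_Mapping.lookup (u (K0_class C T E)) k))
             \<le> K * cmod (Z (K0_class C T E))))"

definition stability_condition ::
    "('o, 'm) tricat \<Rightarrow> 'o set \<Rightarrow> 'o set \<Rightarrow> 'o charge \<Rightarrow> bool" where
  "stability_condition C T H Z \<longleftrightarrow> prestability_condition C T H Z \<and> support_property C T H Z"


section \<open>Semiorthogonal decompositions and gluing\<close>

definition semiorthogonal_decomposition ::
    "('o, 'm) tricat \<Rightarrow> 'o set \<Rightarrow> 'o set \<Rightarrow> bool" where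
  "semiorthogonal_decomposition C A B \<longleftrightarrow>
     triangulated_subcategory C A \<and> triangulated_subcategory C B \<and>
     (\<forall>b\<in>B. \<forall>a\<in>A. Mor C b a = {Null C b a}) \<and>
     (\<forall>E. \<exists>b\<in>B. \<exists>a\<in>A. \<exists>f g h. distinguished C b E a f g h)"

text \<open>Adjoints of the inclusion of a full subcategory, given by their values on objects and their
  (co)units; the universal property determines the action on morphisms.\<close>

definition left_adjoint_of_inclusion ::
    "('o, 'm) tricat \<Rightarrow> 'o set \<Rightarrow> ('o \<Rightarrow> 'o) \<Rightarrow> ('o \<Rightarrow> 'm) \<Rightarrow> bool" where
  "left_adjoint_of_inclusion C A L \<eta> \<longleftrightarrow>
     (\<forall>E. L E \<in> A \<and> \<eta> E \<in> Mor C E (L E) \<and>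
        (\<forall>X\<in>A. \<forall>f\<in>Mor C E X. \<exists>!g. g \<in> Mor C (L E) X \<and> Comp C g (\<eta> E) = f))"

definition right_adjoint_of_inclusion ::
    "('o, 'm) tricat \<Rightarrow> 'o set \<Rightarrow> ('o \<Rightarrow> 'o) \<Rightarrow> ('o \<Rightarrow> 'm) \<Rightarrow> bool" where
  "right_adjoint_of_inclusion C B R \<epsilon> \<longleftrightarrow>
     (\<forall>E. R E \<in> B \<and> \<epsilon> E \<in> Mor C (R E) E \<and>
        (\<forall>X\<in>B. \<forall>f\<in>Mor C X E. \<exists>!g. g \<in> Mor C X (R E) \<and> Comp C (\<epsilon> E) g = f))"

definition hearts_glue :: "('o, 'm) tricat \<Rightarrow> 'o set \<Rightarrow> 'o set \<Rightarrow> bool" where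
  "hearts_glue C A0 B0 \<longleftrightarrow>
     (\<forall>a\<in>A0. \<forall>b\<in>B0. \<forall>i\<le>0. Mor C a (Shift C i b) = {Null C a (Shift C i b)})"

definition glued_heart :: "('o, 'm) tricat \<Rightarrow> 'o set \<Rightarrow> 'o set \<Rightarrow> 'o set" where
  "glued_heart C A0 B0 = extension_closure C (A0 \<union> B0)"

text \<open>The identification of E with a triple (a, b, \<open>\<mu>\<close>): a and b are the images of E under the adjoints
  L and R, and \<open>\<mu>\<close> in Hom(a, b[1]) is the class of the extension formed by the counit \<open>\<epsilon>\<close> and the unit \<open>\<eta>\<close>.\<close>

definition is_triple ::
    "('o, 'm) tricat \<Rightarrow> ('o \<Rightarrow> 'o) \<Rightarrow> ('o \<Rightarrow> 'm) \<Rightarrow> ('o \<Rightarrow> 'o) \<Rightarrow> ('o \<Rightarrow> 'm) \<Rightarrow>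
     'o \<Rightarrow> 'o \<Rightarrow> 'o \<Rightarrow> 'm \<Rightarrow> bool" where
  "is_triple C L \<eta> R \<epsilon> E a b \<mu> \<longleftrightarrow>
     a = L E \<and> b = R E \<and> distinguished C b E a (\<epsilon> E) (\<eta> E) \<mu>"

text \<open>Z is the homomorphism on the Grothendieck group of C written ZA + ZB; it is determined by its values
  on classes of objects.\<close>

definition is_sum_charge ::
    "('o, 'm) tricat \<Rightarrow> 'o set \<Rightarrow> 'o set \<Rightarrow> ('o \<Rightarrow> 'o) \<Rightarrow> ('o \<Rightarrow> 'o) \<Rightarrow>
     'o charge \<Rightarrow> 'o charge \<Rightarrow> 'o charge \<Rightarrow> bool" where
  "is_sum_charge C A B L R ZA ZB Z \<longleftrightarrow>
     Z \<in> hom (K0 C UNIV) complex_group \<and>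
     (\<forall>E. Z (K0_class C UNIV E) = ZA (K0_class C A (L E)) + ZB (K0_class C B (R E)))"

end

theory Submission
  imports Defs
begin

text \<open>Let \<open>E = (A, B, \<mu>)\<close> be semistable of phase \<open>\<phi>\<close> for the glued condition.  The maximal destabilising
  subobject of \<open>B\<close> is a subobject of \<open>E\<close> and the minimal destabilising quotient of \<open>A\<close> is a quotient
  of \<open>E\<close>, so \<open>\<phi>\<^sup>+(B) \<le> \<phi> \<le> \<phi>\<^sup>-(A)\<close>.  If \<open>\<mu> \<noteq> 0\<close>, the hypothesis then forces all phases of the
  Harder--Narasimhan factors of \<open>A\<close> and \<open>B\<close> into an interval of length \<open>1 - \<epsilon>\<close>.  If \<open>\<mu> = 0\<close>, then
  \<open>A\<close> and \<open>B\<close> are direct summands of \<open>E\<close> and all these phases equal \<open>\<phi>\<close>.  Either way the central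
  charges of the factors lie in a sector of angle \<open>\<pi>(1 - \<epsilon>) < \<pi>\<close>, so no cancellation occurs: \<open>\<bar>Z(E)\<bar>\<close> is
  at least \<open>cos (\<pi>(1 - \<epsilon>)/2)\<close> times the sum of their absolute values.  The support properties of the
  two components therefore give one for \<open>\<Lambda>\<^sub>A \<oplus> \<Lambda>\<^sub>B\<close>.\<close>

section \<open>Additive and triangulated categories\<close>

abbreviation (in category) comp (infixr "\<cdot>" 70) where "g \<cdot> f \<equiv> Comp C g f"

context additive_category
begin

section \<open>Groups of morphisms and bilinearity of composition\<close>

lemma carrier_mor_group [simp]: "carrier (mor_group C X Y) = Mor C X Y"
  and mult_mor_group [simp]: "x \<otimes>\<^bsub>mor_group C X Y\<^esub> y = Plus C x y"
  and one_mor_group [simp]: "\<one>\<^bsub>mor_group C X Y\<^esub> = Null C X Y"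
  by (simp_all add: mor_group_def)

lemma group_mor: "group (mor_group C X Y)"
  using mor_comm_group[of X Y] by (simp add: comm_group_def)

lemma null_mor [simp]: "Null C X Y \<in> Mor C X Y"
  using monoid.one_closed[OF group.is_monoid[OF group_mor[of X Y]]] by simp

lemma minus_mor [simp]: "f \<in> Mor C X Y \<Longrightarrow> Minus C X Y f \<in> Mor C X Y"
  using group.inv_closed[OF group_mor[of X Y]] by (simp add: Minus_def)

lemma plus_mor: "\<lbrakk>f \<in> Mor C X Y; g \<in> Mor C X Y\<rbrakk> \<Longrightarrow> Plus C f g \<in> Mor C X Y"
  using monoid.m_closed[OF group.is_monoid[OF group_mor[of X Y]]] by simp

lemma plus_minus: "f \<in> Mor C X Y \<Longrightarrow> Plus C f (Minus C X Y f) = Null C X Y"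
  using group.r_inv[OF group_mor[of X Y]] by (simp add: Minus_def)

lemma plus_null: "f \<in> Mor C X Y \<Longrightarrow> Plus C f (Null C X Y) = f"
  using monoid.r_one[OF group.is_monoid[OF group_mor[of X Y]]] by simp

lemma plus_idem: "\<lbrakk>f \<in> Mor C X Y; Plus C f f = f\<rbrakk> \<Longrightarrow> f = Null C X Y"
  using group.r_cancel_one[OF group_mor[of X Y]] by fastforce

lemma minus_unique:
  assumes "f \<in> Mor C X Y" "g \<in> Mor C X Y" "Plus C f g = Null C X Y"
  shows "g = Minus C X Y f"
proof -
  interpret comm_group "mor_group C X Y" by (rule mor_comm_group)
  show ?thesis unfolding Minus_def using assms m_comm[of f g] inv_equality[of g f] by simp
qed

lemma minus_minus [simp]:
  assumes "f \<in> Mor C X Y" shows "Minus C X Y (Minus C X Y f) = f"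
proof -
  interpret comm_group "mor_group C X Y" by (rule mor_comm_group)
  show ?thesis unfolding Minus_def using assms by (intro inv_inv) simp
qed

lemma eq_if_diff_null:
  assumes "f \<in> Mor C X Y" "g \<in> Mor C X Y" "Plus C f (Minus C X Y g) = Null C X Y"
  shows "f = g"
proof -
  have "Minus C X Y g = Minus C X Y f"
    using minus_unique[OF assms(1) minus_mor[OF assms(2)] assms(3)] .
  then show ?thesis using assms by (metis minus_minus)
qed

lemma comp_null [simp]: assumes "g \<in> Mor C Y Z" shows "g \<cdot> Null C X Y = Null C X Z"
proof -
  have "g \<cdot> Null C X Y = g \<cdot> Plus C (Null C X Y) (Null C X Y)" by (simp add: plus_null)
  also have "\<dots> = Plus C (g \<cdot> Null C X Y) (g \<cdot> Null C X Y)"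
    by (rule comp_plus_right[OF null_mor null_mor assms])
  finally show ?thesis using comp_mor[OF null_mor assms] plus_idem by metis
qed

lemma null_comp [simp]: assumes "f \<in> Mor C X Y" shows "Null C Y Z \<cdot> f = Null C X Z"
proof -
  have "Null C Y Z \<cdot> f = Plus C (Null C Y Z) (Null C Y Z) \<cdot> f" by (simp add: plus_null)
  also have "\<dots> = Plus C (Null C Y Z \<cdot> f) (Null C Y Z \<cdot> f)"
    by (rule comp_plus_left[OF assms null_mor null_mor])
  finally show ?thesis using comp_mor[OF assms null_mor] plus_idem by metis
qed

lemma null_comp_null [simp]: "Null C Y Z \<cdot> Null C X Y = Null C X Z"
  using comp_null[OF null_mor] .

lemma comp_minus: assumes "f \<in> Mor C X Y" "g \<in> Mor C Y Z"
  shows "g \<cdot> Minus C X Y f = Minus C X Z (g \<cdot> f)"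
proof (rule minus_unique)
  show "Plus C (g \<cdot> f) (g \<cdot> Minus C X Y f) = Null C X Z"
    using assms by (simp flip: comp_plus_right add: plus_minus)
qed (use assms comp_mor minus_mor in blast)+

lemma minus_comp: assumes "f \<in> Mor C X Y" "g \<in> Mor C Y Z"
  shows "Minus C Y Z g \<cdot> f = Minus C X Z (g \<cdot> f)"
proof (rule minus_unique)
  show "Plus C (g \<cdot> f) (Minus C Y Z g \<cdot> f) = Null C X Z"
    using assms by (simp flip: comp_plus_left add: plus_minus)
qed (use assms comp_mor minus_mor in blast)+

section \<open>Zero objects and isomorphisms\<close>

lemma zero_object_iff: "zero_object C X \<longleftrightarrow> Ident C X = Null C X X"
proof
  assume "zero_object C X"
  then show "Ident C X = Null C X X"
    unfolding zero_object_def using ident_mor null_mor by blast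
next
  assume *: "Ident C X = Null C X X"
  have "f = Null C X Y" if "f \<in> Mor C X Y" for f Y
    using comp_ident[OF that] comp_null[OF that, of X] * by simp
  moreover have "f = Null C Y X" if "f \<in> Mor C Y X" for f Y
    using ident_comp[OF that] null_comp[OF that, of X] * by simp
  ultimately show "zero_object C X" unfolding zero_object_def using null_mor by blast
qed

lemma from_zero: "\<lbrakk>zero_object C X; f \<in> Mor C X Y\<rbrakk> \<Longrightarrow> f = Null C X Y"
  unfolding zero_object_def using null_mor by blast

lemma to_zero: "\<lbrakk>zero_object C Y; f \<in> Mor C X Y\<rbrakk> \<Longrightarrow> f = Null C X Y"
  unfolding zero_object_def using null_mor by blast

lemma isomorphism_ident: "isomorphism C X X (Ident C X)"
  unfolding isomorphism_def mutually_inverse_def using ident_mor comp_ident by blast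

lemma isomorphism_if_left_right_inverse:
  assumes "f \<in> Mor C X Y" "g \<in> Mor C Y X" "h \<in> Mor C Y X"
    and "g \<cdot> f = Ident C X" "f \<cdot> h = Ident C Y"
  shows "isomorphism C X Y f"
proof -
  have "g = g \<cdot> f \<cdot> h" using assms comp_ident by simp
  also have "\<dots> = (g \<cdot> f) \<cdot> h" using assms comp_assoc by blast
  also have "\<dots> = h" using assms ident_comp by simp
  finally show ?thesis using assms unfolding isomorphism_def mutually_inverse_def by blast
qed

lemma isomorphic_sym: "isomorphic C X Y \<Longrightarrow> isomorphic C Y X"
  unfolding isomorphic_def isomorphism_def mutually_inverse_def by blast

lemma isomorphic_refl [simp]: "isomorphic C X X"
  unfolding isomorphic_def using isomorphism_ident by blast

lemma zero_object_isomorphic: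
  assumes "zero_object C X" "isomorphic C X Y" shows "zero_object C Y"
proof -
  obtain f g where *: "f \<in> Mor C X Y" "g \<in> Mor C Y X" "f \<cdot> g = Ident C Y"
    using assms(2) unfolding isomorphic_def isomorphism_def mutually_inverse_def by blast
  have "Ident C Y = Null C X Y \<cdot> g" using * from_zero[OF assms(1) *(1)] by simp
  then show ?thesis using null_comp[OF *(2)] by (simp add: zero_object_iff)
qed

end

section \<open>The shift functor and vanishing of Hom groups\<close>

context category_with_shift
begin

lemma shift_neg [simp]: "Shift C (- n) (Shift C n X) = X" "Shift C n (Shift C (- n) X) = X"
  using shift_add[of "-n" n X] shift_add[of "n" "-n" X] by (simp_all add: shift_0)

lemma shiftm_neg [simp]:
  assumes "f \<in> Mor C X Y"
  shows "ShiftM C (- n) (ShiftM C n f) = f" "ShiftM C n (ShiftM C (- n) f) = f"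
  using shiftm_add[OF assms, of "-n" n] shiftm_add[OF assms, of "n" "-n"] shiftm_0[OF assms]
  by simp_all

lemma shift_mor_iff:
  assumes "f \<in> Mor C (Shift C n X) (Shift C n Y)"
  obtains g where "g \<in> Mor C X Y" "f = ShiftM C n g"
proof
  show "ShiftM C (-n) f \<in> Mor C X Y" using shift_mor[OF assms, of "-n"] by simp
  show "f = ShiftM C n (ShiftM C (-n) f)" using assms by simp
qed

lemma shiftm_null [simp]: "ShiftM C n (Null C X Y) = Null C (Shift C n X) (Shift C n Y)"
proof -
  have "ShiftM C n (Null C X Y) = Plus C (ShiftM C n (Null C X Y)) (ShiftM C n (Null C X Y))"
    by (metis null_mor plus_null shift_plus)
  then show ?thesis using plus_idem shift_mor null_mor by metis
qed

lemma shiftm_inj: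
  "\<lbrakk>f \<in> Mor C X Y; g \<in> Mor C X Y; ShiftM C n f = ShiftM C n g\<rbrakk> \<Longrightarrow> f = g"
  by (metis shiftm_neg(1))

lemma zero_object_shift [simp]: "zero_object C (Shift C n X) \<longleftrightarrow> zero_object C X"
proof
  assume "zero_object C (Shift C n X)"
  then have "ShiftM C n (Ident C X) = ShiftM C n (Null C X X)"
    by (simp add: zero_object_iff shift_ident)
  then show "zero_object C X" using shiftm_inj ident_mor null_mor zero_object_iff by blast
next
  assume "zero_object C X"
  then show "zero_object C (Shift C n X)" by (metis zero_object_iff shift_ident shiftm_null)
qed

lemma isomorphic_shift:
  assumes "isomorphic C X Y" shows "isomorphic C (Shift C n X) (Shift C n Y)"
proof -
  obtain f g where *: "f \<in> Mor C X Y" "g \<in> Mor C Y X" "f \<cdot> g = Ident C Y" "g \<cdot> f = Ident C X"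
    using assms unfolding isomorphic_def isomorphism_def mutually_inverse_def by blast
  then have "mutually_inverse C (Shift C n X) (Shift C n Y) (ShiftM C n f) (ShiftM C n g)"
    unfolding mutually_inverse_def by (metis shift_comp shift_ident shift_mor)
  then show ?thesis unfolding isomorphic_def isomorphism_def by blast
qed

definition hom_zero :: "'a \<Rightarrow> 'a \<Rightarrow> bool" where
  "hom_zero X Y \<longleftrightarrow> Mor C X Y = {Null C X Y}"

lemma hom_zeroD: "\<lbrakk>hom_zero X Y; f \<in> Mor C X Y\<rbrakk> \<Longrightarrow> f = Null C X Y"
  unfolding hom_zero_def by auto

lemma hom_zeroI: "(\<And>f. f \<in> Mor C X Y \<Longrightarrow> f = Null C X Y) \<Longrightarrow> hom_zero X Y"
  unfolding hom_zero_def using null_mor by auto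

lemma hom_zero_shift [simp]: "hom_zero (Shift C n X) (Shift C n Y) \<longleftrightarrow> hom_zero X Y"
proof
  assume *: "hom_zero (Shift C n X) (Shift C n Y)"
  show "hom_zero X Y"
  proof (rule hom_zeroI)
    fix f assume f: "f \<in> Mor C X Y"
    have "ShiftM C n f = ShiftM C n (Null C X Y)" using hom_zeroD[OF * shift_mor[OF f]] by simp
    then show "f = Null C X Y" using shiftm_inj[OF f null_mor] by blast
  qed
next
  assume *: "hom_zero X Y"
  show "hom_zero (Shift C n X) (Shift C n Y)"
    by (rule hom_zeroI) (metis * hom_zeroD shift_mor_iff shiftm_null)
qed

lemma hom_zero_shift_minus_one:
  "hom_zero (Shift C 1 X) Y \<longleftrightarrow> hom_zero X (Shift C (-1) Y)"
  using hom_zero_shift[of 1 X "Shift C (-1) Y"] by simp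

end

section \<open>Rotation of triangles and exactness of Hom\<close>

context triangulated_category
begin

text \<open>Forgetting the three maps makes rotation free of signs and keeps exactly what functions
  additive on triangles can see.\<close>

definition tri :: "'a \<Rightarrow> 'a \<Rightarrow> 'a \<Rightarrow> bool" where
  "tri X Y Z \<longleftrightarrow> (\<exists>f g h. distinguished C X Y Z f g h)"

lemma triI: "distinguished C X Y Z f g h \<Longrightarrow> tri X Y Z"
  unfolding tri_def by blast

lemma rotate: "distinguished C X Y Z f g h \<Longrightarrow>
  distinguished C Y Z (Shift C 1 X) g h (Minus C (Shift C 1 X) (Shift C 1 Y) (ShiftM C 1 f))"
  using tri_rotate unfolding distinguished_def by blast

text \<open>Shifting is bijective on morphisms, so \<open>- h\<close> is the shift of some
  \<open>k\<close>; rotating the triangle that starts with \<open>k\<close> brings back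
  \<open>h\<close>, since the two signs cancel.\<close>

lemma rotate_back:
  assumes "distinguished C X Y Z f g h"
  obtains k where "distinguished C (Shift C (-1) Z) X Y k f g"
proof -
  have m: "f \<in> Mor C X Y" "g \<in> Mor C Y Z" "h \<in> Mor C Z (Shift C 1 X)"
    using assms unfolding distinguished_def by auto
  have "Minus C Z (Shift C 1 X) h \<in> Mor C (Shift C 1 (Shift C (-1) Z)) (Shift C 1 X)"
    using m by simp
  then obtain k where k: "k \<in> Mor C (Shift C (-1) Z) X" "Minus C Z (Shift C 1 X) h = ShiftM C 1 k"
    by (rule shift_mor_iff)
  have "Minus C (Shift C 1 (Shift C (-1) Z)) (Shift C 1 X) (ShiftM C 1 k) = h"
    using m by (simp flip: k(2))
  then have "distinguished C (Shift C (-1) Z) X Y k f g"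
    using assms m by (subst tri_rotate[OF k(1)]) auto
  then show thesis using that by blast
qed

lemma tri_rot: "tri X Y Z \<Longrightarrow> tri Y Z (Shift C 1 X)"
  unfolding tri_def using rotate by blast

lemma tri_rot_back: "tri X Y Z \<Longrightarrow> tri (Shift C (-1) Z) X Y"
  unfolding tri_def using rotate_back by metis

lemma tri_shift_minus: "tri X Y Z \<Longrightarrow> tri (Shift C (-1) X) (Shift C (-1) Y) (Shift C (-1) Z)"
  using tri_rot_back by blast

text \<open>Comparing with the trivial triangle on \<open>X\<close> makes \<open>g \<cdot> f\<close>
  factor through a zero object.\<close>

lemma distinguished_comp:
  assumes "distinguished C X Y Z f g h" shows "g \<cdot> f = Null C X Z"
proof -
  obtain O' where O': "zero_object C O'" using ex_zero_object by blast
  have m: "f \<in> Mor C X Y" using assms unfolding distinguished_def by auto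
  obtain c where c: "c \<in> Mor C O' Z" "g \<cdot> f = c \<cdot> Null C X O'"
    using tri_morphism[OF tri_ident[OF O', of X] assms ident_mor m refl] by blast
  then show ?thesis using comp_null[OF c(1)] by simp
qed

text \<open>Exactness of Hom(W, -) at \<open>Y\<close>: the pair of \<open>w\<close> and zero is the
  start of a morphism from the rotated trivial triangle on \<open>W\<close> to the rotated given
  triangle, and its third component is the shift of the lift.\<close>

lemma lift:
  assumes d: "distinguished C X Y Z f g h" and w: "w \<in> Mor C W Y" "g \<cdot> w = Null C W Z"
  obtains v where "v \<in> Mor C W X" "f \<cdot> v = w"
proof -
  obtain O' where O': "zero_object C O'" using ex_zero_object by blast
  have m: "f \<in> Mor C X Y" "g \<in> Mor C Y Z" using d unfolding distinguished_def by auto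
  have "g \<cdot> w = Null C O' Z \<cdot> Null C W O'" using w by simp
  then obtain c where c: "c \<in> Mor C (Shift C 1 W) (Shift C 1 X)"
      "Minus C (Shift C 1 X) (Shift C 1 Y) (ShiftM C 1 f) \<cdot> c =
       ShiftM C 1 w \<cdot> Minus C (Shift C 1 W) (Shift C 1 W) (ShiftM C 1 (Ident C W))"
    using tri_morphism[OF rotate[OF tri_ident[OF O', of W]] rotate[OF d] w(1) null_mor] by blast
  from c(1) obtain v where v: "v \<in> Mor C W X" "c = ShiftM C 1 v" by (rule shift_mor_iff)
  have "Minus C (Shift C 1 W) (Shift C 1 Y) (ShiftM C 1 (f \<cdot> v)) =
        Minus C (Shift C 1 X) (Shift C 1 Y) (ShiftM C 1 f) \<cdot> c"
    using minus_comp[OF shift_mor[OF v(1)] shift_mor[OF m(1)]] v m by (simp add: shift_comp)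
  also have "\<dots> = Minus C (Shift C 1 W) (Shift C 1 Y) (ShiftM C 1 w)"
    using c(2) comp_minus[OF ident_mor shift_mor[OF w(1)]] comp_ident[OF shift_mor[OF w(1)]]
    by (simp add: shift_ident)
  finally have "Minus C (Shift C 1 W) (Shift C 1 Y) (ShiftM C 1 (f \<cdot> v)) =
    Minus C (Shift C 1 W) (Shift C 1 Y) (ShiftM C 1 w)" .
  then have "ShiftM C 1 (f \<cdot> v) = ShiftM C 1 w"
    by (metis comp_mor m(1) minus_minus shift_mor v(1) w(1))
  then have "f \<cdot> v = w" using shiftm_inj comp_mor m(1) v(1) w(1) by metis
  then show thesis using that v by blast
qed

lemma tri_zero_ident:
  assumes "zero_object C O'"
  obtains h where "distinguished C O' X X (Null C O' X) (Ident C X) h"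
proof -
  have "zero_object C (Shift C 1 O')" using assms by simp
  then obtain k where "distinguished C O' X X k (Ident C X) (Null C X (Shift C 1 O'))"
    using rotate_back[OF tri_ident] by (metis shift_neg(1))
  moreover then have "k = Null C O' X" using assms from_zero unfolding distinguished_def by blast
  ultimately show thesis using that by blast
qed

text \<open>The dual: \<open>w\<close> is the middle component of a morphism to the triangle 0
  \<rightarrow> W \<rightarrow> W, whose third component is the factorization.\<close>

lemma colift:
  assumes d: "distinguished C X Y Z f g h" and w: "w \<in> Mor C Y W" "w \<cdot> f = Null C X W"
  obtains v where "v \<in> Mor C Z W" "v \<cdot> g = w"
proof -
  obtain O' where O': "zero_object C O'" using ex_zero_object by blast
  have m: "f \<in> Mor C X Y" "g \<in> Mor C Y Z" using d unfolding distinguished_def by auto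
  obtain k where k: "distinguished C O' W W (Null C O' W) (Ident C W) k"
    using tri_zero_ident[OF O'] .
  have "Null C O' W \<cdot> Null C X O' = w \<cdot> f" using w by simp
  then obtain v where "v \<in> Mor C Z W" "Ident C W \<cdot> w = v \<cdot> g"
    using tri_morphism[OF d k null_mor w(1)] by blast
  then show thesis using that w ident_comp by metis
qed

text \<open>The difference of \<open>w\<close> and \<open>w'\<close> is killed by \<open>f\<close>,
  so it lifts along the preceding map Z[-1] \<rightarrow> X; the lift is zero by assumption. The
  next lemma is dual, with the difference factoring through X[1].\<close>

lemma mono_if_hom_zero:
  assumes d: "distinguished C X Y Z f g h" and "hom_zero W (Shift C (-1) Z)"
    and "w \<in> Mor C W X" "w' \<in> Mor C W X" "f \<cdot> w = f \<cdot> w'"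
  shows "w = w'"
proof -
  have f: "f \<in> Mor C X Y" using d unfolding distinguished_def by auto
  let ?d = "Plus C w (Minus C W X w')"
  have m: "?d \<in> Mor C W X" using assms plus_mor by auto
  have "f \<cdot> ?d = Null C W Y"
    using assms f comp_mor[OF assms(4) f]
    by (simp add: comp_plus_right comp_minus plus_minus)
  obtain k where k: "distinguished C (Shift C (-1) Z) X Y k f g" using rotate_back[OF d] .
  obtain v where v: "v \<in> Mor C W (Shift C (-1) Z)" "k \<cdot> v = ?d"
    using lift[OF k m] \<open>f \<cdot> ?d = _\<close> by blast
  have "?d = Null C W X" using v hom_zeroD[OF assms(2) v(1)] k comp_null
    unfolding distinguished_def by metis
  then show ?thesis using eq_if_diff_null assms by blast
qed

lemma epi_if_hom_zero:
  assumes d: "distinguished C X Y Z f g h" and "hom_zero (Shift C 1 X) W"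
    and "w \<in> Mor C Z W" "w' \<in> Mor C Z W" "w \<cdot> g = w' \<cdot> g"
  shows "w = w'"
proof -
  have g: "g \<in> Mor C Y Z" using d unfolding distinguished_def by auto
  let ?d = "Plus C w (Minus C Z W w')"
  have m: "?d \<in> Mor C Z W" using assms plus_mor by auto
  have "?d \<cdot> g = Null C Y W"
    using assms g comp_mor[OF g assms(4)]
    by (simp add: comp_plus_left minus_comp plus_minus)
  then obtain v where v: "v \<in> Mor C (Shift C 1 X) W" "v \<cdot> h = ?d"
    using colift[OF rotate[OF d] m] by blast
  have "?d = Null C Z W" using v hom_zeroD[OF assms(2) v(1)] d null_comp
    unfolding distinguished_def by metis
  then show ?thesis using eq_if_diff_null assms by blast
qed

lemma hom_zero_middle_from:
  assumes "tri X Y Z" "hom_zero X W" "hom_zero Z W" shows "hom_zero Y W"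
proof (rule hom_zeroI)
  fix w assume w: "w \<in> Mor C Y W"
  obtain f g h where d: "distinguished C X Y Z f g h" using assms unfolding tri_def by blast
  then have m: "f \<in> Mor C X Y" "g \<in> Mor C Y Z" unfolding distinguished_def by auto
  obtain v where "v \<in> Mor C Z W" "v \<cdot> g = w"
    using colift[OF d w] hom_zeroD[OF assms(2) comp_mor[OF m(1) w]] by blast
  then show "w = Null C Y W" using hom_zeroD[OF assms(3)] m null_comp by metis
qed

lemma hom_zero_middle_to:
  assumes "tri X Y Z" "hom_zero W X" "hom_zero W Z" shows "hom_zero W Y"
proof (rule hom_zeroI)
  fix w assume w: "w \<in> Mor C W Y"
  obtain f g h where d: "distinguished C X Y Z f g h" using assms unfolding tri_def by blast
  then have m: "f \<in> Mor C X Y" "g \<in> Mor C Y Z" unfolding distinguished_def by auto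
  obtain v where "v \<in> Mor C W X" "f \<cdot> v = w"
    using lift[OF d w] hom_zeroD[OF assms(3) comp_mor[OF w m(2)]] by blast
  then show "w = Null C W Y" using hom_zeroD[OF assms(2)] m comp_null by metis
qed

section \<open>Zero vertices, isomorphic vertices and the octahedral axiom\<close>

lemma iso_if_first_zero:
  assumes d: "distinguished C X Y Z f g h" and X: "zero_object C X"
  shows "isomorphism C Y Z g"
proof -
  have m: "f \<in> Mor C X Y" "g \<in> Mor C Y Z" "h \<in> Mor C Z (Shift C 1 X)"
    using d unfolding distinguished_def by auto
  \<comment> \<open>Since \<open>f\<close> and \<open>h\<close> vanish, \<open>Ident C Y\<close>
    factors through \<open>g\<close> and \<open>Ident C Z\<close> lifts along \<open>g\<close>,
    giving a left and a right inverse.\<close>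
  obtain u where u: "u \<in> Mor C Z Y" "u \<cdot> g = Ident C Y"
    using colift[OF d ident_mor] from_zero[OF X comp_mor[OF m(1) ident_mor]] by blast
  have "h \<cdot> Ident C Z = Null C Z (Shift C 1 X)"
    using to_zero[OF _ comp_mor[OF ident_mor m(3)]] X by simp
  then obtain v where v: "v \<in> Mor C Z Y" "g \<cdot> v = Ident C Z"
    using lift[OF rotate[OF d] ident_mor] by blast
  show ?thesis using isomorphism_if_left_right_inverse m u v by blast
qed

lemma iso_if_third_zero:
  assumes d: "distinguished C X Y Z f g h" and Z: "zero_object C Z"
  shows "isomorphism C X Y f"
proof -
  obtain k where k: "distinguished C (Shift C (-1) Z) X Y k f g" using rotate_back[OF d] .
  show ?thesis using iso_if_first_zero[OF k] Z by simp
qed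

lemma tri_cong:
  assumes "tri X Y Z" "isomorphic C X X'" "isomorphic C Y Y'" "isomorphic C Z Z'"
  shows "tri X' Y' Z'"
proof -
  obtain f g h where d: "distinguished C X Y Z f g h" using assms unfolding tri_def by blast
  then have m: "f \<in> Mor C X Y" "g \<in> Mor C Y Z" "h \<in> Mor C Z (Shift C 1 X)"
    unfolding distinguished_def by auto
  obtain a a' b b' c c' where
    a: "a \<in> Mor C X X'" "a' \<in> Mor C X' X" "a' \<cdot> a = Ident C X" "isomorphism C X X' a" and
    b: "b \<in> Mor C Y Y'" "b' \<in> Mor C Y' Y" "b' \<cdot> b = Ident C Y" "isomorphism C Y Y' b" and
    c: "c \<in> Mor C Z Z'" "c' \<in> Mor C Z' Z" "c' \<cdot> c = Ident C Z" "isomorphism C Z Z' c"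
    using assms(2-4) unfolding isomorphic_def isomorphism_def mutually_inverse_def by metis
  have cancel: "(f' \<cdot> x') \<cdot> x = f'" if "f' \<in> Mor C P Q" "x' \<in> Mor C P' P" "x \<in> Mor C P P'"
    "x' \<cdot> x = Ident C P" for f' x x' P P' Q
    using that by (metis comp_assoc comp_ident)
  have sa: "ShiftM C 1 a \<in> Mor C (Shift C 1 X) (Shift C 1 X')" using a shift_mor by blast
  have bf: "b \<cdot> f \<in> Mor C X Y'" using m b comp_mor by blast
  have cg: "c \<cdot> g \<in> Mor C Y Z'" using m c comp_mor by blast
  have ah: "ShiftM C 1 a \<cdot> h \<in> Mor C Z (Shift C 1 X')" using m sa comp_mor by blast
  \<comment> \<open>The maps of the new triangle are the old ones conjugated by the isomorphisms;
    the squares commute by \<open>cancel\<close>.\<close>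
  have "distinguished C X' Y' Z' ((b \<cdot> f) \<cdot> a') ((c \<cdot> g) \<cdot> b') ((ShiftM C 1 a \<cdot> h) \<cdot> c')"
    using tri_iso[OF d a(4) b(4) c(4) comp_mor[OF a(2) bf] comp_mor[OF b(2) cg] comp_mor[OF c(2) ah]
      cancel[OF bf a(2,1,3)] cancel[OF cg b(2,1,3)] cancel[OF ah c(2,1,3)]] .
  then show ?thesis unfolding tri_def by blast
qed

lemma tri_cong1: "\<lbrakk>tri X Y Z; isomorphic C X X'\<rbrakk> \<Longrightarrow> tri X' Y Z"
  and tri_cong2: "\<lbrakk>tri X Y Z; isomorphic C Y Y'\<rbrakk> \<Longrightarrow> tri X Y' Z"
  and tri_cong3: "\<lbrakk>tri X Y Z; isomorphic C Z Z'\<rbrakk> \<Longrightarrow> tri X Y Z'"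
  using tri_cong isomorphic_refl by blast+

lemma tri_zero_left: "zero_object C O' \<Longrightarrow> tri O' X X"
  using tri_zero_ident triI by metis

lemma tri_zero_right: "zero_object C O' \<Longrightarrow> tri X X O'"
  using tri_ident triI by metis

lemma isomorphic_if_first_zero: "\<lbrakk>tri X Y Z; zero_object C X\<rbrakk> \<Longrightarrow> isomorphic C Y Z"
  unfolding tri_def isomorphic_def using iso_if_first_zero by blast

lemma isomorphic_if_third_zero: "\<lbrakk>tri X Y Z; zero_object C Z\<rbrakk> \<Longrightarrow> isomorphic C X Y"
  unfolding tri_def isomorphic_def using iso_if_third_zero by blast

lemma isomorphic_if_second_zero: "\<lbrakk>tri X Y Z; zero_object C Y\<rbrakk> \<Longrightarrow> isomorphic C Z (Shift C 1 X)"
  using tri_rot isomorphic_if_first_zero by blast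

text \<open>\<open>W\<close> is the cone of the composite Y \<rightarrow> Z \<rightarrow> Z2 shifted
  by -1; in a heart it is the preimage in \<open>Y\<close> of the subobject \<open>Z1\<close> of
  \<open>Z\<close>.\<close>

lemma octahedral_right:
  assumes "tri X Y Z" "tri Z1 Z Z2"
  obtains W where "tri X W Z1" "tri W Y Z2"
proof -
  obtain f g h where d: "distinguished C X Y Z f g h" using assms unfolding tri_def by blast
  obtain i p k where d': "distinguished C Z1 Z Z2 i p k" using assms unfolding tri_def by blast
  have m: "g \<in> Mor C Y Z" "p \<in> Mor C Z Z2" using d d' unfolding distinguished_def by auto
  obtain Q q r where d2: "distinguished C Y Z2 Q (p \<cdot> g) q r"
    using tri_complete[OF comp_mor[OF m]] by blast
  obtain a b where "distinguished C (Shift C 1 X) Q (Shift C 1 Z1) a b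
       (Comp C (ShiftM C 1 h) (Minus C (Shift C 1 Z1) (Shift C 1 Z) (ShiftM C 1 i)))"
    using octahedral[OF rotate[OF d] d2 rotate[OF d']] by blast
  then have "tri (Shift C (-1) (Shift C 1 X)) (Shift C (-1) Q) (Shift C (-1) (Shift C 1 Z1))"
    using triI tri_shift_minus by blast
  moreover have "tri (Shift C (-1) Q) Y Z2" using d2 triI tri_rot_back by blast
  ultimately show thesis using that by simp
qed

text \<open>\<open>W\<close> is the cone of the composite X1 \<rightarrow> X \<rightarrow> Y; in a
  heart it is the quotient of \<open>Y\<close> by \<open>X1\<close>.\<close>

lemma octahedral_left:
  assumes "tri X Y Z" "tri X1 X X2"
  obtains W where "tri X1 Y W" "tri X2 W Z"
proof -
  obtain f g h where d: "distinguished C X Y Z f g h" using assms unfolding tri_def by blast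
  obtain i p k where d': "distinguished C X1 X X2 i p k" using assms unfolding tri_def by blast
  have m: "f \<in> Mor C X Y" "i \<in> Mor C X1 X" using d d' unfolding distinguished_def by auto
  obtain Q q r where d2: "distinguished C X1 Y Q (f \<cdot> i) q r"
    using tri_complete[OF comp_mor[OF m(2,1)]] by blast
  then show thesis using octahedral[OF d' d2 d] that triI by metis
qed

text \<open>A vanishing connecting map yields a section \<open>s\<close> of \<open>g\<close>. The
  octahedron over \<open>g \<cdot> s\<close>, an identity with zero cone, identifies the cone of
  \<open>s\<close> with \<open>X\<close>.\<close>

lemma tri_swap:
  assumes d: "distinguished C X Y Z f g h" and h: "h = Null C Z (Shift C 1 X)"
  shows "tri Z Y X"
proof -
  have m: "g \<in> Mor C Y Z" "h \<in> Mor C Z (Shift C 1 X)" using d unfolding distinguished_def by auto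
  have "h \<cdot> Ident C Z = Null C Z (Shift C 1 X)" using h null_comp[OF ident_mor] by simp
  then obtain s where s: "s \<in> Mor C Z Y" "g \<cdot> s = Ident C Z"
    using lift[OF rotate[OF d] ident_mor] by blast
  obtain Q p r where d1: "distinguished C Z Y Q s p r" using tri_complete[OF s(1)] by blast
  obtain O' where O': "zero_object C O'" using ex_zero_object by blast
  have d2: "distinguished C Z Z O' (g \<cdot> s) (Null C Z O') (Null C O' (Shift C 1 Z))"
    using tri_ident[OF O'] s by simp
  have "tri Q O' (Shift C 1 X)" using octahedral[OF d1 d2 rotate[OF d]] triI by metis
  then have "isomorphic C (Shift C (-1) (Shift C 1 X)) (Shift C (-1) (Shift C 1 Q))"
    using isomorphic_if_second_zero O' isomorphic_shift by blast
  then have "isomorphic C Q X" using isomorphic_sym by simp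
  then show ?thesis using d1 triI tri_cong3 by blast
qed

lemma tri_swap_if_hom_zero:
  assumes "tri X Y Z" "hom_zero Z (Shift C 1 X)" shows "tri Z Y X"
  using assms tri_swap hom_zeroD unfolding tri_def distinguished_def by metis

text \<open>\<open>Y\<close> is an iterated extension of \<open>bX\<close>, \<open>aX\<close>, \<open>bZ\<close> and \<open>aZ\<close>, in this order.  The extension of \<open>bZ\<close>
  by \<open>aX\<close> splits, so these two may be interchanged.\<close>

lemma tri_decompositions:
  assumes t: "tri X Y Z" and x: "tri bX X aX" and z: "tri bZ Z aZ"
    and orth: "hom_zero bZ (Shift C 1 aX)"
  obtains a b where "tri b Y a" "tri bX b bZ" "tri aX a aZ"
proof -
  obtain W where W: "tri X W bZ" "tri W Y aZ" using octahedral_right[OF t z] .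
  obtain V where V: "tri bX W V" "tri aX V bZ" using octahedral_left[OF W(1) x] .
  have "tri bZ V aX" using tri_swap_if_hom_zero[OF V(2) orth] .
  then obtain b where b: "tri bX b bZ" "tri b W aX" using octahedral_right[OF V(1)] by metis
  obtain a where "tri b Y a" "tri aX a aZ" using octahedral_left[OF W(2) b(2)] .
  then show thesis using that b by blast
qed

end

section \<open>Hearts of bounded t-structures\<close>

locale t_structure_on = triangulated_category +
  fixes T U V H :: "'a set"
  assumes subcategory: "triangulated_subcategory C T"
    and bounded: "bounded_t_structure C T U V"
    and heart: "H = U \<inter> V"
begin

lemma t_struct: "t_structure C T U V"
  using bounded unfolding bounded_t_structure_def by simp

lemma subT: "X \<in> U \<Longrightarrow> X \<in> T" "X \<in> V \<Longrightarrow> X \<in> T"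
  using t_struct unfolding t_structure_def by auto

lemma repleteU: "\<lbrakk>X \<in> U; isomorphic C X Y\<rbrakk> \<Longrightarrow> Y \<in> U"
  and repleteV: "\<lbrakk>X \<in> V; isomorphic C X Y\<rbrakk> \<Longrightarrow> Y \<in> V"
  using t_struct unfolding t_structure_def replete_def by blast+

lemma shiftU: "X \<in> U \<Longrightarrow> Shift C 1 X \<in> U"
  and shiftV: "X \<in> V \<Longrightarrow> Shift C (-1) X \<in> V"
  using t_struct unfolding t_structure_def by blast+

lemma orthogonal: "\<lbrakk>X \<in> U; Y \<in> V\<rbrakk> \<Longrightarrow> hom_zero X (Shift C (-1) Y)"
  using t_struct unfolding t_structure_def hom_zero_def by blast

lemma truncation:
  assumes "E \<in> T"
  obtains X Y f g h where "X \<in> U" "Y \<in> V" "distinguished C X E (Shift C (-1) Y) f g h"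
  using assms t_struct unfolding t_structure_def by metis

lemma shiftT: "X \<in> T \<Longrightarrow> Shift C n X \<in> T"
  and coneT: "\<lbrakk>tri X Y Z; X \<in> T; Y \<in> T\<rbrakk> \<Longrightarrow> Z \<in> T"
  and zeroT: "zero_object C X \<Longrightarrow> X \<in> T"
  using subcategory unfolding triangulated_subcategory_def tri_def by blast+

lemma extT: "\<lbrakk>tri X Y Z; X \<in> T; Z \<in> T\<rbrakk> \<Longrightarrow> Y \<in> T"
  using tri_rot_back coneT shiftT by blast

text \<open>The identity and the zero map of S[-1] agree after composition with
  \<open>g = 0\<close>, and Hom(P[1], S[-1]) = 0 makes them equal. So S[-1] is zero and
  \<open>E\<close> is isomorphic to \<open>P\<close>.\<close>

lemma in_U_if_truncation_null:
  assumes P: "P \<in> U" and S: "S \<in> V" and d: "distinguished C P E (Shift C (-1) S) f g h"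
    and g: "g = Null C E (Shift C (-1) S)"
  shows "E \<in> U"
proof -
  have "Ident C (Shift C (-1) S) \<cdot> g = Null C E (Shift C (-1) S) \<cdot> Ident C E"
    using g ident_mor ident_comp[OF null_mor] comp_ident[OF null_mor] by metis
  then have "Ident C (Shift C (-1) S) \<cdot> g = Null C (Shift C (-1) S) (Shift C (-1) S) \<cdot> g"
    using g ident_comp[OF null_mor] by simp
  moreover have "hom_zero (Shift C 1 P) (Shift C (-1) S)"
    using orthogonal shiftU P S by blast
  ultimately have "zero_object C (Shift C (-1) S)"
    using epi_if_hom_zero[OF d _ ident_mor null_mor] zero_object_iff by blast
  then show ?thesis using repleteU P d isomorphic_if_third_zero triI by blast
qed

text \<open>The truncation cuts between \<open>U\<close> and V[-1], so membership in
  \<open>V\<close> is tested on the truncation triangle of E[-1]: if its first map vanishes, then so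
  does \<open>P\<close>.\<close>

lemma in_V_if_truncation_null:
  assumes P: "P \<in> U" and S: "S \<in> V"
    and d: "distinguished C P (Shift C (-1) E) (Shift C (-1) S) f g h"
    and f: "f = Null C P (Shift C (-1) E)"
  shows "E \<in> V"
proof -
  have "f \<cdot> Ident C P = f \<cdot> Null C P P"
    using f comp_ident[OF null_mor] by simp
  moreover have "hom_zero P (Shift C (-1) (Shift C (-1) S))"
    using orthogonal shiftV P S by blast
  ultimately have "zero_object C P"
    using mono_if_hom_zero[OF d _ ident_mor null_mor] zero_object_iff by blast
  then have "isomorphic C (Shift C (-1) E) (Shift C (-1) S)"
    using d isomorphic_if_first_zero triI by blast
  then have "isomorphic C E S" using isomorphic_shift[of _ _ 1] by fastforce
  then show ?thesis using repleteV S isomorphic_sym by blast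
qed

text \<open>Each half of a t-structure is the orthogonal of the other. This makes both halves, and
  hence the heart, closed under extensions.\<close>

lemma in_U_iff: "E \<in> T \<Longrightarrow> E \<in> U \<longleftrightarrow> (\<forall>Y\<in>V. hom_zero E (Shift C (-1) Y))"
proof (intro iffI ballI)
  assume E: "E \<in> T" and *: "\<forall>Y\<in>V. hom_zero E (Shift C (-1) Y)"
  obtain P S f g h where t: "P \<in> U" "S \<in> V" "distinguished C P E (Shift C (-1) S) f g h"
    using truncation[OF E] .
  then have "g = Null C E (Shift C (-1) S)" using * hom_zeroD unfolding distinguished_def by blast
  then show "E \<in> U" using t in_U_if_truncation_null by blast
qed (use orthogonal in blast)

lemma in_V_iff: "E \<in> T \<Longrightarrow> E \<in> V \<longleftrightarrow> (\<forall>X\<in>U. hom_zero X (Shift C (-1) E))"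
proof (intro iffI ballI)
  assume E: "E \<in> T" and *: "\<forall>X\<in>U. hom_zero X (Shift C (-1) E)"
  obtain P S f g h where t: "P \<in> U" "S \<in> V"
    "distinguished C P (Shift C (-1) E) (Shift C (-1) S) f g h"
    using truncation[OF shiftT[OF E]] .
  then have "f = Null C P (Shift C (-1) E)" using * hom_zeroD unfolding distinguished_def by blast
  then show "E \<in> V" using t in_V_if_truncation_null by blast
qed (use orthogonal in blast)

lemma extU: "\<lbrakk>tri X Y Z; X \<in> U; Z \<in> U\<rbrakk> \<Longrightarrow> Y \<in> U"
  by (meson extT hom_zero_middle_from in_U_iff subT(1))

lemma extV: "\<lbrakk>tri X Y Z; X \<in> V; Z \<in> V\<rbrakk> \<Longrightarrow> Y \<in> V"
  by (meson extT hom_zero_middle_to in_V_iff subT(2) tri_shift_minus)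

lemma subH: "X \<in> H \<Longrightarrow> X \<in> T"
  using subT unfolding heart by blast

lemma repleteH: "\<lbrakk>X \<in> H; isomorphic C X Y\<rbrakk> \<Longrightarrow> Y \<in> H"
  using repleteU repleteV unfolding heart by blast

lemma extH: "\<lbrakk>tri X Y Z; X \<in> H; Z \<in> H\<rbrakk> \<Longrightarrow> Y \<in> H"
  using extU extV unfolding heart by blast

lemma zeroH: assumes "zero_object C X" shows "X \<in> H"
proof -
  have "hom_zero X Y" "hom_zero Y (Shift C (-1) X)" for Y
    using from_zero[OF assms] to_zero[of "Shift C (-1) X"] assms by (auto intro: hom_zeroI)
  then show ?thesis using in_U_iff in_V_iff zeroT[OF assms] unfolding heart by blast
qed

lemma orthogonalH: "\<lbrakk>X \<in> H; Y \<in> H\<rbrakk> \<Longrightarrow> hom_zero X (Shift C (-1) Y)"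
  using orthogonal unfolding heart by blast

lemma mono_if_tri:
  assumes d: "distinguished C X Y Z f g h" and "X \<in> H" "Y \<in> H" "Z \<in> H"
  shows "mono_in C H X Y f"
  unfolding mono_in_def
  using assms mono_if_hom_zero[OF d orthogonalH] unfolding distinguished_def by blast

text \<open>Up to a shift, the part of \<open>W\<close> outside the heart is an object \<open>P\<close> of the heart that maps to zero in
  \<open>Y\<close> through \<open>X\<close>; injectivity of \<open>f\<close> kills it.\<close>

lemma cone_of_mono:
  assumes m: "mono_in C H X Y f" and d: "distinguished C X Y W f g h"
  shows "W \<in> H"
proof -
  have XY: "X \<in> H" "Y \<in> H" "X \<in> U" "X \<in> V" "Y \<in> U" "Y \<in> V" "f \<in> Mor C X Y"
    using m unfolding mono_in_def heart by auto
  have "W \<in> U" using extU[OF tri_rot[OF triI[OF d]]] XY shiftU by blast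
  have W1: "Shift C (-1) W \<in> V"
    using extV[OF tri_rot_back[OF tri_rot_back[OF triI[OF d]]]] XY shiftV by blast
  have WT: "W \<in> T" using \<open>W \<in> U\<close> subT by blast
  obtain P S a b c where t: "P \<in> U" "S \<in> V"
    "distinguished C P (Shift C (-1) W) (Shift C (-1) S) a b c"
    using truncation[OF shiftT[OF WT]] .
  have "P \<in> V" using extV[OF tri_rot_back[OF triI[OF t(3)]] _ W1] t shiftV by blast
  then have "P \<in> H" using t unfolding heart by blast
  obtain k where k: "distinguished C (Shift C (-1) W) X Y k f g" using rotate_back[OF d] .
  have mor: "a \<in> Mor C P (Shift C (-1) W)" "k \<in> Mor C (Shift C (-1) W) X"
    using k t unfolding distinguished_def by auto
  have "f \<cdot> (k \<cdot> a) = (f \<cdot> k) \<cdot> a" using mor XY comp_assoc by blast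
  also have "\<dots> = f \<cdot> Null C P X" using distinguished_comp[OF k] mor XY by simp
  finally have "k \<cdot> a = Null C P X"
    using m \<open>P \<in> H\<close> comp_mor[OF mor] null_mor unfolding mono_in_def by blast
  moreover have "hom_zero P (Shift C (-1) Y)" using orthogonal t XY by blast
  ultimately have "a = Null C P (Shift C (-1) W)"
    using mono_if_hom_zero[OF k _ mor(1) null_mor] mor by simp
  then have "W \<in> V" using in_V_if_truncation_null t by blast
  then show ?thesis using \<open>W \<in> U\<close> unfolding heart by blast
qed

lemma mono_if_kernel:
  assumes "kernel_in C H X Y Z f q" shows "mono_in C H X Y f"
  unfolding mono_in_def
proof (intro conjI ballI impI)
  have f: "f \<in> Mor C X Y" "q \<in> Mor C Y Z" "q \<cdot> f = Null C X Z"
    using assms unfolding kernel_in_def by auto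
  fix W g g' assume *: "W \<in> H" "g \<in> Mor C W X" "g' \<in> Mor C W X" "f \<cdot> g = f \<cdot> g'"
  have "q \<cdot> (f \<cdot> g) = Null C W Z" using f comp_assoc[OF *(2) f(1,2)] * by simp
  then have "\<exists>!v. v \<in> Mor C W X \<and> f \<cdot> v = f \<cdot> g"
    using assms * comp_mor[OF *(2) f(1)] unfolding kernel_in_def by blast
  then show "g = g'" using * by metis
qed (use assms in \<open>auto simp: kernel_in_def\<close>)

text \<open>The cone \<open>W\<close> of the kernel \<open>f\<close> lies in the heart, and
  \<open>g\<close> and \<open>q\<close> factor through each other. The two comparison maps are
  mutually inverse because \<open>q\<close> is a cokernel and \<open>g\<close> is epic for maps to
  \<open>W\<close>.\<close>

lemma tri_if_short_exact:
  assumes "short_exact_in C H X Y Z f q" shows "tri X Y Z"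
proof -
  have ker: "kernel_in C H X Y Z f q" and cok: "cokernel_in C H X Y Z f q"
    using assms unfolding short_exact_in_def by auto
  have m: "X \<in> H" "Y \<in> H" "Z \<in> H" "f \<in> Mor C X Y" "q \<in> Mor C Y Z" "q \<cdot> f = Null C X Z"
    using ker unfolding kernel_in_def by auto
  obtain W g h where d: "distinguished C X Y W f g h" using tri_complete[OF m(4)] by blast
  have W: "W \<in> H" using cone_of_mono[OF mono_if_kernel[OF ker] d] .
  have g: "g \<in> Mor C Y W" using d unfolding distinguished_def by auto
  obtain v where v: "v \<in> Mor C Z W" "v \<cdot> q = g"
    using cok W g distinguished_comp[OF d] unfolding cokernel_in_def by blast
  obtain w where w: "w \<in> Mor C W Z" "w \<cdot> g = q" using colift[OF d m(5,6)] .
  have "(w \<cdot> v) \<cdot> q = q" using v w m comp_assoc[OF m(5) v(1) w(1)] by simp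
  then have wv: "w \<cdot> v = Ident C Z"
    using cok m ident_comp[OF m(5)] comp_mor[OF v(1) w(1)] ident_mor[of Z]
    unfolding cokernel_in_def by metis
  have "(v \<cdot> w) \<cdot> g = Ident C W \<cdot> g"
    using v w comp_assoc[OF g w(1) v(1)] ident_comp[OF g] by simp
  moreover have "hom_zero (Shift C 1 X) W"
    using orthogonalH[OF m(1) W] hom_zero_shift_minus_one by blast
  ultimately have "v \<cdot> w = Ident C W"
    using epi_if_hom_zero[OF d _ comp_mor[OF w(1) v(1)] ident_mor] by blast
  then have "isomorphic C W Z" using wv v w isomorphism_if_left_right_inverse
    unfolding isomorphic_def by blast
  then show ?thesis using tri_cong3 d triI by blast
qed

end

section \<open>Grothendieck groups\<close>

lemma comm_group_complex_group: "comm_group complex_group"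
  unfolding complex_group_def
  by (rule comm_groupI) (auto simp: algebra_simps intro: exI[of _ "- _ :: complex"])

lemma complex_group_simps [simp]:
  "carrier complex_group = UNIV" "x \<otimes>\<^bsub>complex_group\<^esub> y = x + y" "\<one>\<^bsub>complex_group\<^esub> = 0"
  by (simp_all add: complex_group_def)

lemma group_complex_group: "group complex_group"
  using comm_group_complex_group comm_group_def by blast

lemma inv_complex_group [simp]: "inv\<^bsub>complex_group\<^esub> x = - x"
  by (rule group.inv_equality[OF group_complex_group]) auto

section \<open>The universal property of the Grothendieck group\<close>

context triangulated_category
begin

text \<open>Such functions correspond to homomorphisms from K_0. The general codomain covers both
  central charges and classes in a lattice.\<close>

definition additive_on :: "'a set \<Rightarrow> ('a \<Rightarrow> 'c::ab_group_add) \<Rightarrow> bool" where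
  "additive_on T \<phi> \<longleftrightarrow> (\<forall>X\<in>T. \<forall>Y\<in>T. \<forall>Z\<in>T. tri X Y Z \<longrightarrow> \<phi> Y = \<phi> X + \<phi> Z)"

lemma additive_onD: "\<lbrakk>additive_on T \<phi>; tri X Y Z; X \<in> T; Y \<in> T; Z \<in> T\<rbrakk> \<Longrightarrow> \<phi> Y = \<phi> X + \<phi> Z"
  unfolding additive_on_def by blast

lemma K0_relations_subset: "K0_relations C T \<subseteq> carrier (free_Abelian_group T)"
proof
  fix x assume "x \<in> K0_relations C T"
  then obtain X Y Z where "X \<in> T" "Y \<in> T" "Z \<in> T" "x = frag_of Y - frag_of X - frag_of Z"
    unfolding K0_relations_def by blast
  then show "x \<in> carrier (free_Abelian_group T)"
    using keys_diff[of "frag_of Y - frag_of X" "frag_of Z"] keys_diff[of "frag_of Y" "frag_of X"]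
    by auto
qed

lemma normal_K0_subgroup: "K0_subgroup C T \<lhd> free_Abelian_group T"
  unfolding K0_subgroup_def
  using comm_group.normal_iff_subgroup[OF abelian_free_Abelian_group]
    group.generate_is_subgroup[OF group_free_Abelian_group K0_relations_subset] by blast

lemma K0_class_mult:
  assumes "tri X Y Z" and T: "X \<in> T" "Y \<in> T" "Z \<in> T"
  shows "K0_class C T Y = K0_class C T X \<otimes>\<^bsub>K0 C T\<^esub> K0_class C T Z"
proof -
  interpret N: normal "K0_subgroup C T" "free_Abelian_group T" by (rule normal_K0_subgroup)
  have k: "Poly_Mapping.keys (frag_of X + frag_of Z) \<subseteq> T"
    using keys_add[of "frag_of X" "frag_of Z"] T by auto
  have "frag_of Y - frag_of X - frag_of Z \<in> K0_relations C T"
    using assms unfolding K0_relations_def tri_def by blast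
  then have "frag_of Y - (frag_of X + frag_of Z) \<in> K0_subgroup C T"
    unfolding K0_subgroup_def by (simp add: generate.incl diff_diff_eq)
  then have "frag_of Y \<otimes>\<^bsub>free_Abelian_group T\<^esub>
      inv\<^bsub>free_Abelian_group T\<^esub> (frag_of X + frag_of Z) \<in> K0_subgroup C T"
    unfolding inv_free_Abelian_group[OF k] mult_free_Abelian_group
    by (simp only: diff_conv_add_uminus)
  then have "frag_of Y \<in> K0_subgroup C T #>\<^bsub>free_Abelian_group T\<^esub> (frag_of X + frag_of Z)"
    using N.rcos_module_rev[of "frag_of X + frag_of Z" "frag_of Y"] N.is_group T k by simp
  then have "K0_class C T Y = K0_subgroup C T #>\<^bsub>free_Abelian_group T\<^esub> (frag_of X + frag_of Z)"
    unfolding K0_class_def using N.repr_independence[OF _ _ N.is_subgroup] k by simp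
  also have "\<dots> = K0_class C T X \<otimes>\<^bsub>K0 C T\<^esub> K0_class C T Z"
    unfolding K0_class_def K0_def using N.rcos_sum[of "frag_of X" "frag_of Z"] T
    by (simp add: FactGroup_def)
  finally show ?thesis .
qed

lemma K0_class_carrier: "X \<in> T \<Longrightarrow> K0_class C T X \<in> carrier (K0 C T)"
  unfolding K0_class_def K0_def FactGroup_def RCOSETS_def by auto

lemma additive_on_charge:
  assumes "Z \<in> hom (K0 C T) complex_group" shows "additive_on T (\<lambda>X. Z (K0_class C T X))"
  unfolding additive_on_def
proof (intro ballI impI)
  fix X Y W assume *: "X \<in> T" "Y \<in> T" "W \<in> T" "tri X Y W"
  show "Z (K0_class C T Y) = Z (K0_class C T X) + Z (K0_class C T W)"
    using hom_mult[OF assms K0_class_carrier[OF *(1)] K0_class_carrier[OF *(3)]]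
      K0_class_mult[OF *(4,1,2,3)] by simp
qed

lemma additive_on_frag:
  assumes "u \<in> hom (K0 C T) (free_Abelian_group S)" shows "additive_on T (\<lambda>X. u (K0_class C T X))"
  unfolding additive_on_def
proof (intro ballI impI)
  fix X Y W assume *: "X \<in> T" "Y \<in> T" "W \<in> T" "tri X Y W"
  show "u (K0_class C T Y) = u (K0_class C T X) + u (K0_class C T W)"
    using hom_mult[OF assms K0_class_carrier[OF *(1)] K0_class_carrier[OF *(3)]]
      K0_class_mult[OF *(4,1,2,3)] by simp
qed

text \<open>Extend \<open>\<phi>\<close> to the free abelian group; additivity puts the defining
  relations into the kernel, so the extension descends to the quotient.\<close>

lemma K0_hom_exists:
  assumes \<phi>: "additive_on T \<phi>" and keys: "\<And>X. X \<in> T \<Longrightarrow> Poly_Mapping.keys (\<phi> X) \<subseteq> S"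
  obtains u where "u \<in> hom (K0 C T) (free_Abelian_group S)"
    "\<And>X. X \<in> T \<Longrightarrow> u (K0_class C T X) = \<phi> X"
proof -
  have "\<phi> ` T \<subseteq> carrier (free_Abelian_group S)" using keys by auto
  then obtain h where h: "h \<in> hom (free_Abelian_group T) (free_Abelian_group S)"
    "\<And>X. X \<in> T \<Longrightarrow> h (frag_of X) = \<phi> X"
    using comm_group.free_Abelian_group_universal[OF abelian_free_Abelian_group] by blast
  interpret h: group_hom "free_Abelian_group T" "free_Abelian_group S" h
    using h(1) by (intro group_hom.intro group_hom_axioms.intro) simp_all
  have "K0_relations C T \<subseteq> kernel (free_Abelian_group T) (free_Abelian_group S) h"
  proof
    fix x assume x: "x \<in> K0_relations C T"
    then obtain X Y Z where *: "X \<in> T" "Y \<in> T" "Z \<in> T" "tri X Y Z"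
      "x = frag_of Y - frag_of X - frag_of Z"
      unfolding K0_relations_def tri_def by blast
    have "Poly_Mapping.keys (frag_of Y - frag_of X) \<subseteq> T"
      using keys_diff[of "frag_of Y" "frag_of X"] * by auto
    then have "h x = \<phi> Y - \<phi> X - \<phi> Z"
      using * h(2) hom_frag_diff[OF h(1), of "frag_of Y" "frag_of X"]
        hom_frag_diff[OF h(1), of "frag_of Y - frag_of X" "frag_of Z"] by simp
    then have "h x = 0" using additive_onD[OF \<phi> *(4)] * by simp
    then show "x \<in> kernel (free_Abelian_group T) (free_Abelian_group S) h"
      using subsetD[OF K0_relations_subset x] unfolding kernel_def by simp
  qed
  then have "K0_subgroup C T \<subseteq> kernel (free_Abelian_group T) (free_Abelian_group S) h"
    unfolding K0_subgroup_def
    using group.generate_subgroup_incl[OF group_free_Abelian_group _ h.subgroup_kernel] by blast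
  then obtain u where u: "u \<in> hom (K0 C T) (free_Abelian_group S)"
    "\<And>x. x \<in> carrier (free_Abelian_group T) \<Longrightarrow>
      u (K0_subgroup C T #>\<^bsub>free_Abelian_group T\<^esub> x) = h x"
    using h.FactGroup_universal_kernel[OF normal_K0_subgroup] unfolding K0_def by metis
  show thesis
  proof (rule that[OF u(1)])
    fix X assume "X \<in> T"
    then show "u (K0_class C T X) = \<phi> X"
      using u(2)[of "frag_of X"] h(2) unfolding K0_class_def by simp
  qed
qed

text \<open>Classes of objects generate K_0. The induction on the free group builds elements from
  generators by differences, so compatibility with differences is what has to be checked.\<close>

lemma K0_hom_eqI:
  assumes f: "f \<in> hom (K0 C T) complex_group" and g: "g \<in> hom (K0 C T) complex_group"
    and eq: "\<And>X. X \<in> T \<Longrightarrow> f (K0_class C T X) = g (K0_class C T X)" and x: "x \<in> carrier (K0 C T)"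
  shows "f x = g x"
proof -
  let ?F = "free_Abelian_group T" and ?N = "K0_subgroup C T"
  interpret N: normal ?N ?F by (rule normal_K0_subgroup)
  define c where "c y = ?N #>\<^bsub>?F\<^esub> y" for y
  have c: "c \<in> hom ?F (K0 C T)"
    unfolding K0_def c_def using N.r_coset_hom_Mod by (simp add: o_def)
  have diff: "k (c (a - b)) = k (c a) - k (c b)"
    if "k \<in> hom (K0 C T) complex_group" "Poly_Mapping.keys a \<subseteq> T" "Poly_Mapping.keys b \<subseteq> T" for k a b
  proof -
    interpret k: group_hom ?F complex_group "k \<circ> c"
      using hom_compose[OF c that(1)] group_complex_group
      by (intro group_hom.intro group_hom_axioms.intro) simp_all
    have "(k \<circ> c) (a + - b) = (k \<circ> c) a + - (k \<circ> c) b"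
      using k.hom_mult[of a "- b"] k.hom_inv[of b] that by simp
    then show ?thesis by simp
  qed
  obtain y where y: "Poly_Mapping.keys y \<subseteq> T" "x = c y"
    using x unfolding K0_def FactGroup_def RCOSETS_def c_def by auto
  have "f (c y) = g (c y)"
    using y(1)
  proof (induction rule: free_Abelian_group_induct[consumes 1])
    case 1
    show ?case using diff[OF f, of 0 0] diff[OF g, of 0 0] by simp
  next
    case (2 a b)
    then show ?case using diff[OF f 2(1,2)] diff[OF g 2(1,2)] by simp
  next
    case (3 a)
    then show ?case using eq unfolding K0_class_def c_def by simp
  qed
  then show ?thesis using y by simp
qed

end

section \<open>Additive functions on a triangulated subcategory\<close>

locale triangulated_sub = triangulated_category +
  fixes T :: "'a set"
  assumes subcategory: "triangulated_subcategory C T"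
begin

lemma T_shift: "X \<in> T \<Longrightarrow> Shift C n X \<in> T"
  and T_zero: "zero_object C X \<Longrightarrow> X \<in> T"
  and T_iso: "\<lbrakk>X \<in> T; isomorphic C X Y\<rbrakk> \<Longrightarrow> Y \<in> T"
  using subcategory unfolding triangulated_subcategory_def replete_def by blast+

lemma T_ext:
  assumes "tri X Y Z" "X \<in> T" "Z \<in> T" shows "Y \<in> T"
proof -
  obtain f g h where "distinguished C (Shift C (-1) Z) X Y f g h"
    using tri_rot_back[OF assms(1)] unfolding tri_def by blast
  then show ?thesis
    using subcategory assms(2) T_shift[OF assms(3)] unfolding triangulated_subcategory_def by blast
qed

lemma additive_zero: assumes "additive_on T \<phi>" "zero_object C X" shows "\<phi> X = 0"
  using additive_onD[OF assms(1) tri_zero_left[OF assms(2)]] T_zero[OF assms(2)] by fastforce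

lemma additive_iso:
  assumes \<phi>: "additive_on T \<phi>" and X: "X \<in> T" "isomorphic C X Y" shows "\<phi> X = \<phi> Y"
proof -
  obtain O' where O': "zero_object C O'" using ex_zero_object by blast
  have "tri O' X Y" using tri_cong3[OF tri_zero_left[OF O'] X(2)] .
  then show ?thesis
    using additive_onD[OF \<phi>] additive_zero[OF \<phi> O'] T_iso X T_zero[OF O'] by fastforce
qed

lemma additive_shift_one: assumes \<phi>: "additive_on T \<phi>" and X: "X \<in> T"
  shows "\<phi> (Shift C 1 X) = - \<phi> X"
proof -
  obtain O' where O': "zero_object C O'" using ex_zero_object by blast
  have "tri X O' (Shift C 1 X)" using tri_rot[OF tri_zero_left[OF O', of X]]
    tri_rot tri_zero_right[OF O', of X] by blast
  then have "\<phi> O' = \<phi> X + \<phi> (Shift C 1 X)"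
    using additive_onD[OF \<phi>] T_shift X T_zero[OF O'] by blast
  then show ?thesis using additive_zero[OF \<phi> O'] by (simp add: eq_neg_iff_add_eq_0 add.commute)
qed

text \<open>The triangle X \<rightarrow> 0 \<rightarrow> X[1] costs one sign per shift. Hence norms
  and absolute values do not change when a semistable object of the heart is shifted into another
  slice.\<close>

lemma additive_shift: assumes \<phi>: "additive_on T \<phi>" and X: "X \<in> T"
  shows "\<phi> (Shift C n X) = (if even n then \<phi> X else - \<phi> X)"
proof (induction n rule: int_induct[where k = 0])
  case base
  show ?case by (simp add: shift_0)
next
  case (step1 i)
  have "Shift C (i + 1) X = Shift C 1 (Shift C i X)" using shift_add[of 1 i X] by (simp add: add.commute)
  then show ?case using step1 additive_shift_one[OF \<phi> T_shift[OF X]] by simp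
next
  case (step2 i)
  have "Shift C 1 (Shift C (i - 1) X) = Shift C i X" using shift_add[of 1 "i - 1" X] by simp
  then show ?case using step2 additive_shift_one[OF \<phi> T_shift[OF X], of "i - 1"]
    by (auto split: if_splits)
qed

end

section \<open>Phases and Harder--Narasimhan filtrations\<close>

text \<open>The imaginary part is \<open>cmod w * cmod z * sin (Arg w - Arg z)\<close>, and the
  difference of two arguments in (0, \<pi>] lies where the sine has the sign of its argument.
  Comparisons of phases thus become inequalities additive in each charge.\<close>

lemma Arg_le_iff:
  assumes "z \<noteq> 0" "w \<noteq> 0" "0 < Arg z" "0 < Arg w"
  shows "Arg z \<le> Arg w \<longleftrightarrow> 0 \<le> Im (w * cnj z)"
proof -
  have "w * cnj z = rcis (cmod w) (Arg w) * rcis (cmod z) (- Arg z)"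
    by (metis complex_cnj_cnj complex_cnj_mult rcis_cmod_Arg cis_cnj rcis_def complex_cnj_complex_of_real)
  then have "Im (w * cnj z) = cmod w * cmod z * sin (Arg w - Arg z)"
    by (simp add: rcis_mult)
  moreover have "0 \<le> sin (Arg w - Arg z) \<longleftrightarrow> Arg z \<le> Arg w"
    using assms Arg_bounded[of z] Arg_bounded[of w] sin_ge_zero[of "Arg w - Arg z"]
      sin_gt_zero[of "Arg z - Arg w"] sin_minus[of "Arg z - Arg w"] by fastforce
  moreover have "0 < cmod w * cmod z" using assms by simp
  ultimately show ?thesis by (metis mult_le_cancel_left_pos mult_zero_right)
qed

text \<open>Rotation by the bisector of the sector moves each \<open>z i\<close> to within
  \<open>pi * w / 2\<close> of the positive real axis, where the real part is at least the cosine
  times the modulus. The bound is kept as a real part after a fixed rotation so that the bounds for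
  several families in one sector can be added.\<close>

lemma sector_sum_bound:
  assumes "\<And>i. i \<in> I \<Longrightarrow> lo \<le> Arg (z i) / pi \<and> Arg (z i) / pi \<le> lo + w" and w: "0 \<le> w" "w \<le> 1"
  shows "cos (pi * w / 2) * (\<Sum>i\<in>I. cmod (z i)) \<le> Re (cis (- pi * (lo + w / 2)) * (\<Sum>i\<in>I. z i))"
proof -
  let ?t = "pi * (lo + w / 2)"
  have "cos (pi * w / 2) * cmod (z i) \<le> Re (cis (- ?t) * z i)" if "i \<in> I" for i
  proof -
    have "pi * lo \<le> Arg (z i)" "Arg (z i) \<le> pi * (lo + w)"
      using assms(1)[OF that] by (simp_all add: field_simps)
    then have "Arg (z i) - ?t \<le> pi * w / 2" "?t - Arg (z i) \<le> pi * w / 2"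
      by (simp_all add: algebra_simps)
    then have "\<bar>Arg (z i) - ?t\<bar> \<le> pi * w / 2" by linarith
    then have "cos (pi * w / 2) \<le> cos \<bar>Arg (z i) - ?t\<bar>"
      using w by (intro cos_monotone_0_pi_le) (auto simp: mult_le_cancel_left_pos
        intro: order_trans[of _ "pi * 1"])
    then have "cos (pi * w / 2) * cmod (z i) \<le> cos (Arg (z i) - ?t) * cmod (z i)"
      by (intro mult_right_mono) auto
    also have "\<dots> = Re (cis (- ?t) * rcis (cmod (z i)) (Arg (z i)))"
      using rcis_mult[of 1 "- ?t" "cmod (z i)" "Arg (z i)"]
      by (simp only: cis_rcis_eq Re_rcis mult_1 uminus_add_conv_diff mult.commute)
    finally show ?thesis by (simp add: rcis_cmod_Arg)
  qed
  then have "(\<Sum>i\<in>I. cos (pi * w / 2) * cmod (z i)) \<le> (\<Sum>i\<in>I. Re (cis (- ?t) * z i))"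
    by (rule sum_mono)
  then show ?thesis by (simp only: sum_distrib_left Re_sum mult_minus_left)
qed

section \<open>The heart, the semistable objects and the extremal phases\<close>

locale prestable = triangulated_sub +
  fixes H :: "'a set" and Z :: "'a charge"
  assumes prestable: "prestability_condition C T H Z"
begin

definition charge :: "'a \<Rightarrow> complex" where "charge X = Z (K0_class C T X)"

lemma additive_charge: "additive_on T charge"
  unfolding charge_def using additive_on_charge prestable unfolding prestability_condition_def by blast

lemma heart_ex: "\<exists>U V. t_structure_on C T U V H"
  using prestable subcategory triangulated_category_axioms
  unfolding prestability_condition_def heart_of_bounded_t_structure_def
    t_structure_on_def t_structure_on_axioms_def by blast

text \<open>None of these facts mentions \<open>U\<close> and \<open>V\<close>, so any bounded
  t-structure with heart \<open>H\<close> provides them.\<close>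

lemma H_sub: "X \<in> H \<Longrightarrow> X \<in> T"
  and H_iso: "\<lbrakk>X \<in> H; isomorphic C X Y\<rbrakk> \<Longrightarrow> Y \<in> H"
  and H_ext: "\<lbrakk>tri X Y W; X \<in> H; W \<in> H\<rbrakk> \<Longrightarrow> Y \<in> H"
  and H_zero: "zero_object C X \<Longrightarrow> X \<in> H"
  and H_mono: "\<lbrakk>distinguished C X Y W f g h; X \<in> H; Y \<in> H; W \<in> H\<rbrakk> \<Longrightarrow> mono_in C H X Y f"
  and H_short_exact: "short_exact_in C H X Y W f q \<Longrightarrow> tri X Y W"
  using heart_ex t_structure_on.subH t_structure_on.repleteH t_structure_on.extH
    t_structure_on.zeroH t_structure_on.mono_if_tri t_structure_on.tri_if_short_exact
  by metis+

lemma charge_add: "\<lbrakk>tri X Y W; X \<in> H; W \<in> H\<rbrakk> \<Longrightarrow> charge Y = charge X + charge W"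
  using additive_onD[OF additive_charge] H_ext H_sub by blast

lemma phase_charge: "phase C T Z X = Arg (charge X) / pi"
  by (simp add: phase_def charge_def)

lemma charge_upper:
  assumes "X \<in> H" "\<not> zero_object C X" shows "charge X \<noteq> 0" "0 < Arg (charge X)"
proof -
  obtain r t where *: "0 < r" "0 < t" "t \<le> 1" "charge X = rcis r (pi * t)"
    using prestable assms unfolding prestability_condition_def stability_function_def charge_def
    by blast
  then show "charge X \<noteq> 0" by simp
  have "Arg (charge X) = pi * t"
  proof (rule cis_Arg_unique)
    show "sgn (charge X) = cis (pi * t)" using * by (simp add: rcis_def sgn_mult sgn_of_real)
    show "- pi < pi * t" using * mult_pos_pos[OF pi_gt_zero *(2)] pi_gt_zero by linarith
  qed (use * in simp)
  then show "0 < Arg (charge X)" using * by simp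
qed

lemma semistable_sub:
  assumes "semistable C T H Z E" "tri X E Q" "X \<in> H" "Q \<in> H" "\<not> zero_object C X"
  shows "phase C T Z X \<le> phase C T Z E"
  using assms H_mono unfolding semistable_def tri_def by blast

text \<open>The see-saw principle: with E = X + Q on charges, the imaginary parts of
  \<open>charge E * cnj (charge X)\<close> and of \<open>charge Q * cnj (charge E)\<close>
  coincide.\<close>

lemma semistable_quotient:
  assumes ss: "semistable C T H Z E" and t: "tri X E Q" and "X \<in> H" "Q \<in> H" "\<not> zero_object C Q"
  shows "phase C T Z E \<le> phase C T Z Q"
proof (cases "zero_object C X")
  case True
  then show ?thesis
    using charge_add[OF t] assms additive_zero[OF additive_charge] by (simp add: phase_charge)
next
  case False
  have E: "E \<in> H" "\<not> zero_object C E" using ss unfolding semistable_def by auto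
  have "Arg (charge X) \<le> Arg (charge E)"
    using semistable_sub[OF ss t] assms False by (simp add: phase_charge divide_le_cancel)
  then have "0 \<le> Im (charge E * cnj (charge X))"
    using Arg_le_iff charge_upper E assms False by blast
  then have "0 \<le> Im (charge Q * cnj (charge E))"
    using charge_add[OF t] assms by (simp add: algebra_simps)
  then have "Arg (charge E) \<le> Arg (charge Q)"
    using Arg_le_iff charge_upper E assms by blast
  then show ?thesis by (simp add: phase_charge divide_le_cancel)
qed

lemma HN_filtrationD:
  assumes "HN_filtration C T H Z X n E F i q" "k < n"
  shows "tri (E k) (E (Suc k)) (F k)" "E k \<in> H" "F k \<in> H" "semistable C T H Z (F k)"
    "E (Suc k) \<in> H"
proof -
  have *: "short_exact_in C H (E k) (E (Suc k)) (F k) (i k) (q k)"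
    and "semistable C T H Z (F k)"
    using assms unfolding HN_filtration_def by auto
  then show "tri (E k) (E (Suc k)) (F k)" "semistable C T H Z (F k)" "E k \<in> H" "F k \<in> H"
    "E (Suc k) \<in> H"
    using H_short_exact[OF *] unfolding short_exact_in_def kernel_in_def by auto
qed

lemma HN_filtration_sum:
  assumes HN: "HN_filtration C T H Z X n E F i q" and \<phi>: "additive_on T \<phi>"
  shows "\<phi> X = (\<Sum>k<n. \<phi> (F k))"
proof -
  have z: "zero_object C (E 0)" "E n = X" using HN unfolding HN_filtration_def by auto
  have "\<phi> (E m) = (\<Sum>k<m. \<phi> (F k))" if "m \<le> n" for m
    using that
  proof (induction m)
    case 0
    show ?case using additive_zero[OF \<phi> z(1)] by simp
  next
    case (Suc m)
    then show ?case using additive_onD[OF \<phi> HN_filtrationD(1)[OF HN]] HN_filtrationD[OF HN, of m] H_sub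
      by simp
  qed
  then show ?thesis using z by auto
qed

text \<open>Going down from \<open>E n = X\<close>, each step enlarges the quotient of
  \<open>X\<close> by one more factor and stays in the heart. At \<open>E 1\<close> the subobject is
  \<open>F 0\<close>, because \<open>E 0\<close> is zero.\<close>

lemma HN_filtration_first:
  assumes HN: "HN_filtration C T H Z X n E F i q"
  obtains Q where "Q \<in> H" "tri (F 0) X Q"
proof -
  obtain O' where O': "zero_object C O'" using ex_zero_object by blast
  have z: "zero_object C (E 0)" "E n = X" "0 < n" using HN unfolding HN_filtration_def by auto
  have "1 \<le> n" using z by simp
  then have "\<exists>Q\<in>H. tri (E 1) X Q"
  proof (induction rule: inc_induct)
    case base
    show ?case using tri_zero_right[OF O'] H_zero[OF O'] z by blast
  next
    case (step m)
    then obtain Q where Q: "Q \<in> H" "tri (E (Suc m)) X Q" by blast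
    obtain W where "tri (E m) X W" "tri (F m) W Q"
      using octahedral_left[OF Q(2) HN_filtrationD(1)[OF HN step(2)]] .
    then show ?case using H_ext HN_filtrationD(3)[OF HN step(2)] Q by blast
  qed
  moreover have "isomorphic C (E 1) (F 0)"
    using isomorphic_if_first_zero[OF HN_filtrationD(1)[OF HN z(3)] z(1)] by simp
  ultimately show thesis using that tri_cong1 by blast
qed

lemma HN_filtration_last:
  assumes HN: "HN_filtration C T H Z X n E F i q"
  obtains K where "K \<in> H" "tri K X (F (n - 1))"
proof -
  have "E n = X" "n - 1 < n" "Suc (n - 1) = n" using HN unfolding HN_filtration_def by auto
  then show thesis using that HN_filtrationD[OF HN, of "n - 1"] by simp
qed

text \<open>The filtration taken is one that realises the set of phases picked in
  \<open>HN_phases\<close>, so the extremal phases are those of its own first and last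
  factors.\<close>

lemma HN_filtration_ex:
  assumes X: "X \<in> H" "\<not> zero_object C X"
  obtains n E F i q where "HN_filtration C T H Z X n E F i q"
    "phi_plus C T H Z X = phase C T Z (F 0)" "phi_minus C T H Z X = phase C T Z (F (n - 1))"
    "\<And>k. k < n \<Longrightarrow> phi_minus C T H Z X \<le> phase C T Z (F k) \<and> phase C T Z (F k) \<le> phi_plus C T H Z X"
    "phi_minus C T H Z X \<le> phi_plus C T H Z X"
proof -
  have "\<exists>S n E F i q. HN_filtration C T H Z X n E F i q \<and> S = (\<lambda>k. phase C T Z (F k)) ` {..<n}"
    using prestable X unfolding prestability_condition_def HN_property_def by blast
  from someI_ex[OF this] obtain n E F i q where HN: "HN_filtration C T H Z X n E F i q"
    and S: "HN_phases C T H Z X = (\<lambda>k. phase C T Z (F k)) ` {..<n}"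
    unfolding HN_phases_def by blast
  have n: "0 < n" using HN unfolding HN_filtration_def by blast
  have mono: "phase C T Z (F l) \<le> phase C T Z (F k)" if "k \<le> l" "l < n" for k l
    using HN that unfolding HN_filtration_def by (cases "k = l") (auto simp: less_imp_le)
  have p: "phi_plus C T H Z X = phase C T Z (F 0)"
    unfolding phi_plus_def S using n mono by (intro Max_eqI) auto
  have m: "phi_minus C T H Z X = phase C T Z (F (n - 1))"
    unfolding phi_minus_def S using n mono by (intro Min_eqI) auto
  show thesis using that[OF HN p m] p m mono n by simp
qed

end

section \<open>Norms on direct sums of lattices\<close>

definition frag_norm :: "((nat \<Rightarrow> real) \<Rightarrow> real) \<Rightarrow> (nat \<Rightarrow>\<^sub>0 int) \<Rightarrow> real" where
  "frag_norm N x = N (\<lambda>k. real_of_int (Poly_Mapping.lookup x k))"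

lemma is_normD:
  assumes "is_norm r N" "\<And>k. r \<le> k \<Longrightarrow> x k = 0"
  shows "0 \<le> N x" "N x = 0 \<longleftrightarrow> x = (\<lambda>_. 0)" "N (\<lambda>k. c * x k) = \<bar>c\<bar> * N x"
    "(\<And>k. r \<le> k \<Longrightarrow> y k = 0) \<Longrightarrow> N (\<lambda>k. x k + y k) \<le> N x + N y"
proof -
  have *: "\<forall>k\<ge>r. x k = 0" using assms by simp
  note N = mp[OF spec[OF assms(1)[unfolded is_norm_def], of x] *]
  show "0 \<le> N x" by (rule N[THEN conjunct1])
  show "N x = 0 \<longleftrightarrow> x = (\<lambda>_. 0)" by (rule N[THEN conjunct2, THEN conjunct1])
  show "N (\<lambda>k. c * x k) = \<bar>c\<bar> * N x" by (rule N[THEN conjunct2, THEN conjunct2, THEN conjunct1, rule_format])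
  show "N (\<lambda>k. x k + y k) \<le> N x + N y" if "\<And>k. r \<le> k \<Longrightarrow> y k = 0"
    using spec[OF N[THEN conjunct2, THEN conjunct2, THEN conjunct2], of y] that by simp
qed

lemma lookup_eq_0_if_keys:
  fixes r :: nat
  assumes "Poly_Mapping.keys x \<subseteq> {..<r}" "r \<le> k" shows "Poly_Mapping.lookup x k = 0"
proof -
  have "k \<notin> Poly_Mapping.keys x" using assms by auto
  then show ?thesis by (simp add: in_keys_iff)
qed

lemma frag_norm_zero: "is_norm r N \<Longrightarrow> frag_norm N 0 = 0"
  unfolding is_norm_def frag_norm_def by simp

lemma frag_norm_add:
  "\<lbrakk>is_norm r N; Poly_Mapping.keys x \<subseteq> {..<r}; Poly_Mapping.keys y \<subseteq> {..<r}\<rbrakk>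
    \<Longrightarrow> frag_norm N (x + y) \<le> frag_norm N x + frag_norm N y"
  unfolding is_norm_def frag_norm_def by (simp add: lookup_eq_0_if_keys lookup_add)

lemma frag_norm_minus:
  assumes "is_norm r N" "Poly_Mapping.keys x \<subseteq> {..<r}" shows "frag_norm N (- x) = frag_norm N x"
proof -
  show ?thesis
    using is_normD(3)[OF assms(1), of "\<lambda>k. real_of_int (Poly_Mapping.lookup x k)" "-1"]
      lookup_eq_0_if_keys[OF assms(2)]
    unfolding frag_norm_def by simp
qed

lemma frag_norm_sum:
  assumes N: "is_norm r N" and "finite I" "\<And>i. i \<in> I \<Longrightarrow> Poly_Mapping.keys (x i) \<subseteq> {..<r}"
  shows "frag_norm N (\<Sum>i\<in>I. x i) \<le> (\<Sum>i\<in>I. frag_norm N (x i))"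
  using assms(2,3)
proof (induction I rule: finite_induct)
  case empty
  then show ?case using frag_norm_zero[OF N] by simp
next
  case (insert i I)
  have "Poly_Mapping.keys (\<Sum>i\<in>I. x i) \<subseteq> {..<r}"
    using sum_closed_free_Abelian_group[of I x "{..<r}"] insert by simp
  then have "frag_norm N (x i + (\<Sum>i\<in>I. x i)) \<le> frag_norm N (x i) + frag_norm N (\<Sum>i\<in>I. x i)"
    using frag_norm_add[OF N] insert by simp
  then show ?case using insert by simp
qed

text \<open>The inclusion of the second summand of \<open>\<int>\<^sup>r \<oplus> \<int>\<^sup>s\<close>, realised on \<open>{..<r + s}\<close>.\<close>

definition shift_frag :: "nat \<Rightarrow> (nat \<Rightarrow>\<^sub>0 int) \<Rightarrow> nat \<Rightarrow>\<^sub>0 int" where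
  "shift_frag r = frag_extend (\<lambda>k. frag_of (k + r))"

lemma shift_frag_diff: "shift_frag r (x - y) = shift_frag r x - shift_frag r y"
  by (simp add: shift_frag_def frag_extend_diff)

lemma shift_frag_add: "shift_frag r (x + y) = shift_frag r x + shift_frag r y"
  by (simp add: shift_frag_def frag_extend_add)

lemma lookup_shift_frag:
  "Poly_Mapping.lookup (shift_frag r x) k = (if k < r then 0 else Poly_Mapping.lookup x (k - r))"
proof -
  have "Poly_Mapping.keys x \<subseteq> UNIV" by simp
  then show ?thesis
  proof (induction x rule: free_Abelian_group_induct[consumes 1])
    case 1
    show ?case by (simp add: shift_frag_def)
  next
    case (2 x y)
    then show ?case by (simp add: shift_frag_diff lookup_minus)
  next
    case (3 a)
    show ?case by (auto simp: shift_frag_def)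
  qed
qed

lemma keys_shift_frag:
  assumes "Poly_Mapping.keys x \<subseteq> {..<s}"
  shows "Poly_Mapping.keys (shift_frag r x) \<subseteq> {..<r + s}"
proof
  fix k assume "k \<in> Poly_Mapping.keys (shift_frag r x)"
  then have "r \<le> k" "k - r \<in> Poly_Mapping.keys x"
    by (auto simp: in_keys_iff lookup_shift_frag split: if_splits)
  then show "k \<in> {..<r + s}" using assms by auto
qed

text \<open>The sum of the norms of the two components of \<real>^r \<oplus> \<real>^s. Cutting off
  at \<open>r\<close> is essential: \<open>N\<close> is controlled only on sequences that vanish
  from \<open>r\<close> on.\<close>

definition sum_norm ::
  "nat \<Rightarrow> ((nat \<Rightarrow> real) \<Rightarrow> real) \<Rightarrow> ((nat \<Rightarrow> real) \<Rightarrow> real) \<Rightarrow> (nat \<Rightarrow> real) \<Rightarrow> real" where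
  "sum_norm r N N' x = N (\<lambda>k. if k < r then x k else 0) + N' (\<lambda>k. x (k + r))"

lemma is_norm_sum_norm:
  assumes N: "is_norm r N" and N': "is_norm s N'" shows "is_norm (r + s) (sum_norm r N N')"
  unfolding is_norm_def
proof (intro allI impI conjI)
  fix x :: "nat \<Rightarrow> real" assume x: "\<forall>k\<ge>r + s. x k = 0"
  let ?a = "\<lambda>x k. if k < r then x k else (0 :: real)" and ?b = "\<lambda>(x :: nat \<Rightarrow> real) k. x (k + r)"
  have a: "?a x k = 0" if "r \<le> k" for x k using that by simp
  have b: "?b x k = 0" if "s \<le> k" for k using x that by simp
  have nonneg: "0 \<le> N (?a x)" "0 \<le> N' (?b x)"
    using is_normD(1)[OF N, of "?a x"] is_normD(1)[OF N', of "?b x"] a b by blast+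
  then show "0 \<le> sum_norm r N N' x" by (simp add: sum_norm_def)
  have "?a x = (\<lambda>_. 0) \<and> ?b x = (\<lambda>_. 0) \<longleftrightarrow> x = (\<lambda>_. 0)"
  proof
    assume *: "?a x = (\<lambda>_. 0) \<and> ?b x = (\<lambda>_. 0)"
    have "x k = 0" for k
      using fun_cong[OF conjunct1[OF *], of k] fun_cong[OF conjunct2[OF *], of "k - r"]
      by (cases "k < r") auto
    then show "x = (\<lambda>_. 0)" by blast
  qed auto
  moreover have "N (?a x) = 0 \<longleftrightarrow> ?a x = (\<lambda>_. 0)" "N' (?b x) = 0 \<longleftrightarrow> ?b x = (\<lambda>_. 0)"
    using is_normD(2)[OF N, of "?a x"] is_normD(2)[OF N', of "?b x"] a b by blast+
  ultimately show "sum_norm r N N' x = 0 \<longleftrightarrow> x = (\<lambda>_. 0)"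
    using nonneg by (simp add: sum_norm_def add_nonneg_eq_0_iff)
  show "sum_norm r N N' (\<lambda>k. c * x k) = \<bar>c\<bar> * sum_norm r N N' x" for c
  proof -
    have "N (\<lambda>k. c * ?a x k) = \<bar>c\<bar> * N (?a x)" "N' (\<lambda>k. c * ?b x k) = \<bar>c\<bar> * N' (?b x)"
      using is_normD(3)[OF N, of "?a x"] is_normD(3)[OF N', of "?b x"] a b by blast+
    moreover have "(\<lambda>k. c * ?a x k) = ?a (\<lambda>k. c * x k)" by auto
    ultimately show ?thesis by (simp add: sum_norm_def distrib_left)
  qed
  fix y :: "nat \<Rightarrow> real" assume y: "\<forall>k\<ge>r + s. y k = 0"
  then have c: "?b y k = 0" if "s \<le> k" for k using that by simp
  have "N (\<lambda>k. ?a x k + ?a y k) \<le> N (?a x) + N (?a y)"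
    "N' (\<lambda>k. ?b x k + ?b y k) \<le> N' (?b x) + N' (?b y)"
    using is_normD(4)[OF N, of "?a x" "?a y"] is_normD(4)[OF N', of "?b x" "?b y"] a b c by blast+
  moreover have "(\<lambda>k. ?a x k + ?a y k) = ?a (\<lambda>k. x k + y k)" by auto
  ultimately show "sum_norm r N N' (\<lambda>k. x k + y k) \<le> sum_norm r N N' x + sum_norm r N N' y"
    by (simp add: sum_norm_def)
qed

lemma frag_norm_sum_norm:
  assumes "Poly_Mapping.keys x \<subseteq> {..<r}"
  shows "frag_norm (sum_norm r N N') (x + shift_frag r y) = frag_norm N x + frag_norm N' y"
proof -
  have "(\<lambda>k. if k < r then real_of_int (Poly_Mapping.lookup (x + shift_frag r y) k) else 0) =
      (\<lambda>k. real_of_int (Poly_Mapping.lookup x k))"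
    "(\<lambda>k. real_of_int (Poly_Mapping.lookup (x + shift_frag r y) (k + r))) =
      (\<lambda>k. real_of_int (Poly_Mapping.lookup y k))"
    using lookup_eq_0_if_keys[OF assms] by (auto simp: lookup_add lookup_shift_frag)
  then show ?thesis unfolding frag_norm_def sum_norm_def by simp
qed

lemma complex_hom_diff:
  assumes l: "l \<in> hom (free_Abelian_group S) complex_group"
    and "Poly_Mapping.keys x \<subseteq> S" "Poly_Mapping.keys y \<subseteq> S"
  shows "l (x - y) = l x - l y"
proof -
  have "Poly_Mapping.keys (x - y) \<subseteq> S" using keys_diff[of x y] assms by blast
  then have "l (x - y) + l y = l x" using hom_mult[OF l, of "x - y" y] assms by simp
  then show ?thesis by (simp add: algebra_simps)
qed

text \<open>\<open>m\<close> is fixed on the basis, by \<open>l\<close> below \<open>r\<close> and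
  by \<open>l'\<close> from \<open>r\<close> on; the two restrictions are then compared on
  generators and differences.\<close>

lemma sum_charge_exists:
  assumes l: "l \<in> hom (free_Abelian_group {..<r}) complex_group"
    and l': "l' \<in> hom (free_Abelian_group {..<s}) complex_group"
  obtains m where "m \<in> hom (free_Abelian_group {..<r + s}) complex_group"
    "\<And>x y. \<lbrakk>Poly_Mapping.keys x \<subseteq> {..<r}; Poly_Mapping.keys y \<subseteq> {..<s}\<rbrakk> \<Longrightarrow>
      m (x + shift_frag r y) = l x + l' y"
proof -
  obtain m where m: "m \<in> hom (free_Abelian_group {..<r + s}) complex_group"
    "\<And>k. k \<in> {..<r + s} \<Longrightarrow> m (frag_of k) = (if k < r then l (frag_of k) else l' (frag_of (k - r)))"
    using comm_group.free_Abelian_group_universal[OF comm_group_complex_group,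
      of "\<lambda>k. if k < r then l (frag_of k) else l' (frag_of (k - r))" "{..<r + s}"] by auto
  have keys: "Poly_Mapping.keys x \<subseteq> {..<r} \<Longrightarrow> Poly_Mapping.keys x \<subseteq> {..<r + s}" for x :: "nat \<Rightarrow>\<^sub>0 int"
    by force
  have m1: "m x = l x" if "Poly_Mapping.keys x \<subseteq> {..<r}" for x
    using that
  proof (induction x rule: free_Abelian_group_induct[consumes 1])
    case 1
    show ?case using complex_hom_diff[OF m(1), of 0 0] complex_hom_diff[OF l, of 0 0] by simp
  next
    case (2 x y)
    then show ?case using complex_hom_diff[OF m(1)] complex_hom_diff[OF l] keys by simp
  next
    case (3 a)
    then show ?case using m(2)[of a] by simp
  qed
  have m2: "m (shift_frag r y) = l' y" if "Poly_Mapping.keys y \<subseteq> {..<s}" for y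
    using that
  proof (induction y rule: free_Abelian_group_induct[consumes 1])
    case 1
    show ?case using complex_hom_diff[OF m(1), of 0 0] complex_hom_diff[OF l', of 0 0]
      by (simp add: shift_frag_def)
  next
    case (2 x y)
    then show ?case using complex_hom_diff[OF m(1)] complex_hom_diff[OF l'] keys_shift_frag
      by (simp add: shift_frag_diff)
  next
    case (3 a)
    then show ?case using m(2)[of "a + r"] by (simp add: shift_frag_def)
  qed
  show thesis
  proof (rule that[OF m(1)])
    fix x y :: "nat \<Rightarrow>\<^sub>0 int"
    assume "Poly_Mapping.keys x \<subseteq> {..<r}" "Poly_Mapping.keys y \<subseteq> {..<s}"
    then show "m (x + shift_frag r y) = l x + l' y"
      using hom_mult[OF m(1), of x "shift_frag r y"] m1 m2 keys keys_shift_frag by simp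
  qed
qed

section \<open>Semistable objects and smaller hearts\<close>

context prestable
begin

text \<open>Adding the support inequalities of the Harder--Narasimhan factors bounds the norm by the
  sum of the moduli of their charges, which may exceed the modulus of \<open>charge X\<close>. The
  phases are recorded to exclude cancellation later; for a zero object the sum is empty and the
  condition on phases is vacuous.\<close>

lemma HN_support:
  assumes \<phi>: "additive_on T \<phi>" and keys: "\<And>X. X \<in> T \<Longrightarrow> Poly_Mapping.keys (\<phi> X) \<subseteq> {..<r}"
    and N: "is_norm r N"
    and K: "\<And>F. semistable C T H Z F \<Longrightarrow> frag_norm N (\<phi> F) \<le> K * cmod (charge F)"
    and X: "X \<in> H"
  obtains n :: nat and z where "charge X = (\<Sum>k<n. z k)"
    "frag_norm N (\<phi> X) \<le> K * (\<Sum>k<n. cmod (z k))"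
    "\<And>k. k < n \<Longrightarrow> \<not> zero_object C X \<and>
      phi_minus C T H Z X \<le> Arg (z k) / pi \<and> Arg (z k) / pi \<le> phi_plus C T H Z X"
proof (cases "zero_object C X")
  case True
  show thesis
    using that[of "\<lambda>_. 0" 0] additive_zero[OF additive_charge True] additive_zero[OF \<phi> True]
      frag_norm_zero[OF N] by simp
next
  case False
  obtain n E F i q where HN: "HN_filtration C T H Z X n E F i q"
    and ph: "\<And>k. k < n \<Longrightarrow> phi_minus C T H Z X \<le> phase C T Z (F k) \<and> phase C T Z (F k) \<le> phi_plus C T H Z X"
    using HN_filtration_ex[OF X False] by metis
  note F = HN_filtrationD[OF HN]
  have "frag_norm N (\<phi> X) \<le> (\<Sum>k<n. frag_norm N (\<phi> (F k)))"
    using frag_norm_sum[OF N, of "{..<n}" "\<lambda>k. \<phi> (F k)"] keys F(3) H_sub HN_filtration_sum[OF HN \<phi>]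
    by simp
  also have "\<dots> \<le> (\<Sum>k<n. K * cmod (charge (F k)))" using K F(4) by (intro sum_mono) simp
  finally show thesis
    using that[OF HN_filtration_sum[OF HN additive_charge]] ph False
    by (simp add: sum_distrib_left phase_charge)
qed

text \<open>The first factor of \<open>P\<close> in the smaller heart is a subobject of
  \<open>E\<close> in the larger one: its quotient \<open>W\<close> is an extension of
  \<open>Q\<close> by \<open>R\<close>. By \<open>eq\<close> its phase is the same on both
  sides.\<close>

lemma phi_plus_le:
  assumes small: "prestable C T' H' Z'" and sub: "H' \<subseteq> H"
    and eq: "\<forall>X\<in>H'. Z' (K0_class C T' X) = Z (K0_class C T X)"
    and E: "semistable C T H Z E" "tri P E Q" "P \<in> H'" "Q \<in> H" "\<not> zero_object C P"
  shows "phi_plus C T' H' Z' P \<le> phase C T Z E"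
proof -
  interpret small: prestable C T' H' Z' by (rule small)
  obtain n G F i q where HN: "HN_filtration C T' H' Z' P n G F i q"
    "phi_plus C T' H' Z' P = phase C T' Z' (F 0)"
    using small.HN_filtration_ex[OF E(3,5)] by metis
  then have "0 < n" unfolding HN_filtration_def by blast
  then have F: "F 0 \<in> H'" "\<not> zero_object C (F 0)"
    using small.HN_filtrationD[OF HN(1)] unfolding semistable_def by blast+
  obtain R where R: "R \<in> H'" "tri (F 0) P R" using small.HN_filtration_first[OF HN(1)] .
  obtain W where W: "tri (F 0) E W" "tri R W Q" using octahedral_left[OF E(2) R(2)] .
  have "phase C T Z (F 0) \<le> phase C T Z E"
    using semistable_sub[OF E(1) W(1)] H_ext[OF W(2)] F R sub E by blast
  then show ?thesis using HN(2) bspec[OF eq F(1)] by (simp add: phase_def)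
qed

text \<open>Dually, the last factor of \<open>Q\<close> is a quotient of \<open>E\<close>, with
  kernel an extension of \<open>R\<close> by \<open>P\<close>.\<close>

lemma phi_minus_ge:
  assumes small: "prestable C T' H' Z'" and sub: "H' \<subseteq> H"
    and eq: "\<forall>X\<in>H'. Z' (K0_class C T' X) = Z (K0_class C T X)"
    and E: "semistable C T H Z E" "tri P E Q" "P \<in> H" "Q \<in> H'" "\<not> zero_object C Q"
  shows "phase C T Z E \<le> phi_minus C T' H' Z' Q"
proof -
  interpret small: prestable C T' H' Z' by (rule small)
  obtain n G F i q where HN: "HN_filtration C T' H' Z' Q n G F i q"
    "phi_minus C T' H' Z' Q = phase C T' Z' (F (n - 1))"
    using small.HN_filtration_ex[OF E(4,5)] by metis
  then have "n - 1 < n" unfolding HN_filtration_def by simp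
  then have F: "F (n - 1) \<in> H'" "\<not> zero_object C (F (n - 1))"
    using small.HN_filtrationD[OF HN(1)] unfolding semistable_def by blast+
  obtain R where R: "R \<in> H'" "tri R Q (F (n - 1))" using small.HN_filtration_last[OF HN(1)] .
  obtain W where W: "tri P W R" "tri W E (F (n - 1))" using octahedral_right[OF E(2) R(2)] .
  have "phase C T Z E \<le> phase C T Z (F (n - 1))"
    using semistable_quotient[OF E(1) W(2)] H_ext[OF W(1)] F R sub E by blast
  then show ?thesis using HN(2) bspec[OF eq F(1)] by (simp add: phase_def)
qed

end

section \<open>Semiorthogonal decompositions and gluing\<close>

locale semiorthogonal = triangulated_category +
  fixes A B :: "'a set" and L R :: "'a \<Rightarrow> 'a" and \<eta> \<epsilon> :: "'a \<Rightarrow> 'b"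
  assumes sod: "semiorthogonal_decomposition C A B"
    and left_adjoint: "left_adjoint_of_inclusion C A L \<eta>"
    and right_adjoint: "right_adjoint_of_inclusion C B R \<epsilon>"
begin

lemma subcategory_A: "triangulated_subcategory C A"
  and subcategory_B: "triangulated_subcategory C B"
  using sod unfolding semiorthogonal_decomposition_def by auto

sublocale A: triangulated_sub C A by unfold_locales (rule subcategory_A)
sublocale B: triangulated_sub C B by unfold_locales (rule subcategory_B)

lemma semiorthogonal: "\<lbrakk>b \<in> B; a \<in> A\<rbrakk> \<Longrightarrow> hom_zero b a"
  using sod unfolding semiorthogonal_decomposition_def hom_zero_def by blast

lemma L_in: "L E \<in> A" and unit_mor: "\<eta> E \<in> Mor C E (L E)"
  using left_adjoint unfolding left_adjoint_of_inclusion_def by blast+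

lemma R_in: "R E \<in> B" and counit_mor: "\<epsilon> E \<in> Mor C (R E) E"
  using right_adjoint unfolding right_adjoint_of_inclusion_def by blast+

lemma L_unique:
  "\<lbrakk>X \<in> A; f \<in> Mor C (L E) X; g \<in> Mor C (L E) X; f \<cdot> \<eta> E = g \<cdot> \<eta> E\<rbrakk> \<Longrightarrow> f = g"
  using left_adjoint comp_mor[OF unit_mor] unfolding left_adjoint_of_inclusion_def by metis

lemma R_unique:
  "\<lbrakk>X \<in> B; f \<in> Mor C X (R E); g \<in> Mor C X (R E); \<epsilon> E \<cdot> f = \<epsilon> E \<cdot> g\<rbrakk> \<Longrightarrow> f = g"
  using right_adjoint comp_mor[OF _ counit_mor] unfolding right_adjoint_of_inclusion_def by metis

text \<open>Adjunction factors \<open>f\<close> through the counit, and Hom(R E, a) = 0 factors the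
  counit through \<open>f\<close>; the two factorizations are mutually inverse. The same happens for
  \<open>g\<close> and the unit, so the given triangle can be transported to the canonical
  one.\<close>

lemma adjoint_triangle:
  assumes d: "distinguished C b E a f g h" and b: "b \<in> B" and a: "a \<in> A"
  shows "isomorphic C b (R E)" "isomorphic C a (L E)"
    "\<exists>\<mu>. distinguished C (R E) E (L E) (\<epsilon> E) (\<eta> E) \<mu>"
proof -
  have m: "f \<in> Mor C b E" "g \<in> Mor C E a" "h \<in> Mor C a (Shift C 1 b)"
    using d unfolding distinguished_def by auto
  obtain w where w: "w \<in> Mor C b (R E)" "\<epsilon> E \<cdot> w = f"
    using right_adjoint m(1) b unfolding right_adjoint_of_inclusion_def by blast
  obtain v where v: "v \<in> Mor C (R E) b" "f \<cdot> v = \<epsilon> E"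
    using lift[OF d counit_mor hom_zeroD[OF semiorthogonal[OF R_in a] comp_mor[OF counit_mor m(2)]]] .
  have "\<epsilon> E \<cdot> (w \<cdot> v) = \<epsilon> E \<cdot> Ident C (R E)"
    using v w comp_assoc[OF v(1) w(1) counit_mor] comp_ident[OF counit_mor] by simp
  then have wv: "w \<cdot> v = Ident C (R E)"
    using R_unique[OF R_in comp_mor[OF v(1) w(1)] ident_mor] by blast
  have "f \<cdot> (v \<cdot> w) = f \<cdot> Ident C b"
    using v w comp_assoc[OF w(1) v(1) m(1)] comp_ident[OF m(1)] by simp
  then have vw: "v \<cdot> w = Ident C b"
    using mono_if_hom_zero[OF d semiorthogonal[OF b A.T_shift[OF a]] comp_mor[OF w(1) v(1)] ident_mor]
    by blast
  have iso_w: "isomorphism C b (R E) w"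
    using isomorphism_if_left_right_inverse[OF w(1) v(1) v(1) vw wv] .
  obtain w' where w': "w' \<in> Mor C (L E) a" "w' \<cdot> \<eta> E = g"
    using left_adjoint m(2) a unfolding left_adjoint_of_inclusion_def by blast
  obtain v' where v': "v' \<in> Mor C a (L E)" "v' \<cdot> g = \<eta> E"
    using colift[OF d unit_mor hom_zeroD[OF semiorthogonal[OF b L_in] comp_mor[OF m(1) unit_mor]]] .
  have "(v' \<cdot> w') \<cdot> \<eta> E = Ident C (L E) \<cdot> \<eta> E"
    using v' w' comp_assoc[OF unit_mor w'(1) v'(1)] ident_comp[OF unit_mor] by simp
  then have vw': "v' \<cdot> w' = Ident C (L E)"
    using L_unique[OF L_in comp_mor[OF w'(1) v'(1)] ident_mor] by blast
  have "(w' \<cdot> v') \<cdot> g = Ident C a \<cdot> g"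
    using v' w' comp_assoc[OF m(2) v'(1) w'(1)] ident_comp[OF m(2)] by simp
  then have wv': "w' \<cdot> v' = Ident C a"
    using epi_if_hom_zero[OF d semiorthogonal[OF B.T_shift[OF b] a] comp_mor[OF v'(1) w'(1)] ident_mor]
    by blast
  have iso_v': "isomorphism C a (L E) v'"
    using isomorphism_if_left_right_inverse[OF v'(1) w'(1) w'(1) wv' vw'] .
  let ?w1 = "ShiftM C 1 w"
  have w1: "?w1 \<in> Mor C (Shift C 1 b) (Shift C 1 (R E))" using shift_mor[OF w(1)] .
  have "(?w1 \<cdot> (h \<cdot> w')) \<cdot> v' = ?w1 \<cdot> ((h \<cdot> w') \<cdot> v')"
    using comp_assoc[OF v'(1) comp_mor[OF w'(1) m(3)] w1] by simp
  also have "(h \<cdot> w') \<cdot> v' = h"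
    using comp_assoc[OF v'(1) w'(1) m(3)] wv' comp_ident[OF m(3)] by simp
  \<comment> \<open>The class of the extension is \<open>h\<close> transported along the
    isomorphisms at both ends.\<close>
  finally have "distinguished C (R E) E (L E) (\<epsilon> E) (\<eta> E) (?w1 \<cdot> (h \<cdot> w'))"
    using tri_iso[OF d iso_w isomorphism_ident iso_v' counit_mor unit_mor
      comp_mor[OF comp_mor[OF w'(1) m(3)] w1]] w v' comp_ident[OF unit_mor] ident_comp[OF m(1)]
    by simp
  then show "\<exists>\<mu>. distinguished C (R E) E (L E) (\<epsilon> E) (\<eta> E) \<mu>" by blast
  show "isomorphic C b (R E)" "isomorphic C a (L E)"
    using iso_w iso_v' unfolding isomorphic_def by blast+
qed

lemma R_iso: "\<lbrakk>tri b E a; b \<in> B; a \<in> A\<rbrakk> \<Longrightarrow> isomorphic C b (R E)"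
  and L_iso: "\<lbrakk>tri b E a; b \<in> B; a \<in> A\<rbrakk> \<Longrightarrow> isomorphic C a (L E)"
  using adjoint_triangle(1,2) unfolding tri_def by blast+

lemma canonical_triangle: obtains \<mu> where "distinguished C (R E) E (L E) (\<epsilon> E) (\<eta> E) \<mu>"
proof -
  obtain b a f g h where "b \<in> B" "a \<in> A" "distinguished C b E a f g h"
    using sod unfolding semiorthogonal_decomposition_def by metis
  then show thesis using that adjoint_triangle(3) by blast
qed

lemma canonical_tri: "tri (R E) E (L E)"
  using canonical_triangle triI by metis

text \<open>Semiorthogonality lets the decompositions of \<open>X\<close> and \<open>Z\<close> be
  merged into one of \<open>Y\<close>, and any decomposition of \<open>Y\<close> has the vertices
  \<open>R Y\<close> and \<open>L Y\<close> up to isomorphism.\<close>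

lemma tri_adjoints: assumes "tri X Y Z" shows "tri (L X) (L Y) (L Z)" "tri (R X) (R Y) (R Z)"
proof -
  obtain b a where ba: "tri b Y a" "tri (R X) b (R Z)" "tri (L X) a (L Z)"
    using tri_decompositions[OF assms canonical_tri canonical_tri
      semiorthogonal[OF R_in A.T_shift[OF L_in]]] .
  have "b \<in> B" "a \<in> A"
    using B.T_ext[OF ba(2) R_in R_in] A.T_ext[OF ba(3) L_in L_in] by auto
  then show "tri (L X) (L Y) (L Z)" "tri (R X) (R Y) (R Z)"
    using ba L_iso R_iso tri_cong2 by blast+
qed

lemma adjoints_A: assumes "E \<in> A" shows "isomorphic C E (L E)" "zero_object C (R E)"
proof -
  obtain O' where O': "zero_object C O'" using ex_zero_object by blast
  have "isomorphic C O' (R E)" "isomorphic C E (L E)"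
    using R_iso L_iso tri_zero_left[OF O'] B.T_zero[OF O'] assms by blast+
  then show "isomorphic C E (L E)" "zero_object C (R E)" using zero_object_isomorphic O' by blast+
qed

lemma adjoints_B: assumes "E \<in> B" shows "isomorphic C E (R E)" "zero_object C (L E)"
proof -
  obtain O' where O': "zero_object C O'" using ex_zero_object by blast
  have "isomorphic C O' (L E)" "isomorphic C E (R E)"
    using R_iso L_iso tri_zero_right[OF O'] A.T_zero[OF O'] assms by blast+
  then show "isomorphic C E (R E)" "zero_object C (L E)" using zero_object_isomorphic O' by blast+
qed

lemma additive_L: "additive_on A \<phi> \<Longrightarrow> additive_on UNIV (\<lambda>X. \<phi> (L X))"
  and additive_R: "additive_on B \<psi> \<Longrightarrow> additive_on UNIV (\<lambda>X. \<psi> (R X))"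
  using tri_adjoints L_in R_in unfolding additive_on_def by blast+

end

section \<open>Charges and phases for the glued heart\<close>

locale glued = semiorthogonal +
  fixes A0 B0 :: "'a set" and ZA ZB Zgl :: "'a charge"
  assumes prestable_A: "prestability_condition C A A0 ZA"
    and prestable_B: "prestability_condition C B B0 ZB"
    and prestable_gl: "prestability_condition C UNIV (glued_heart C A0 B0) Zgl"
    and sum_charge: "is_sum_charge C A B L R ZA ZB Zgl"
begin

abbreviation Hgl where "Hgl \<equiv> glued_heart C A0 B0"

sublocale A: prestable C A A0 ZA
  by (intro prestable.intro prestable_axioms.intro A.triangulated_sub_axioms prestable_A)

sublocale B: prestable C B B0 ZB
  by (intro prestable.intro prestable_axioms.intro B.triangulated_sub_axioms prestable_B)

lemma subcategory_UNIV: "triangulated_subcategory C UNIV"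
  unfolding triangulated_subcategory_def replete_def by blast

sublocale gl: prestable C UNIV Hgl Zgl
  by (intro prestable.intro triangulated_sub.intro triangulated_sub_axioms.intro
      prestable_axioms.intro triangulated_category_axioms subcategory_UNIV prestable_gl)

lemma A0_sub: "A0 \<subseteq> Hgl" and B0_sub: "B0 \<subseteq> Hgl"
  unfolding glued_heart_def by (auto intro: extension_closure.base)

lemma charge_gl: "gl.charge E = A.charge (L E) + B.charge (R E)"
  using sum_charge unfolding is_sum_charge_def A.charge_def B.charge_def gl.charge_def by blast

lemma charge_A0: "\<forall>X\<in>A0. ZA (K0_class C A X) = Zgl (K0_class C UNIV X)"
  using charge_gl A.additive_iso[OF A.additive_charge] adjoints_A A.H_sub
    B.additive_zero[OF B.additive_charge]
  unfolding A.charge_def gl.charge_def by simp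

lemma charge_B0: "\<forall>X\<in>B0. ZB (K0_class C B X) = Zgl (K0_class C UNIV X)"
  using charge_gl B.additive_iso[OF B.additive_charge] adjoints_B B.H_sub
    A.additive_zero[OF A.additive_charge]
  unfolding B.charge_def gl.charge_def by simp

text \<open>Induction over the extension closure: the adjoints are exact and each kills the other
  component, while \<open>A0\<close> and \<open>B0\<close> are closed under extensions.\<close>

lemma glued_components: assumes "E \<in> Hgl" shows "L E \<in> A0" "R E \<in> B0"
proof -
  have "L E \<in> A0 \<and> R E \<in> B0"
    using assms unfolding glued_heart_def
  proof (induction rule: extension_closure.induct)
    case (base X)
    then consider "X \<in> A0" | "X \<in> B0" by blast
    then show ?case
    proof cases
      case 1
      then show ?thesis using adjoints_A[OF A.H_sub[OF 1]] A.H_iso B.H_zero by blast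
    next
      case 2
      then show ?thesis using adjoints_B[OF B.H_sub[OF 2]] B.H_iso A.H_zero by blast
    qed
  next
    case (zero X)
    then show ?case
      using adjoints_A(1)[OF A.T_zero] adjoints_B(1)[OF B.T_zero] A.H_iso B.H_iso A.H_zero B.H_zero
      by blast
  next
    case (ext X Y Z f g h)
    then show ?case using tri_adjoints[OF triI[OF ext(1)]] A.H_ext B.H_ext by blast
  qed
  then show "L E \<in> A0" "R E \<in> B0" by auto
qed

text \<open>The point is a single \<open>lo\<close> for both components: the charges of all factors
  of \<open>L E\<close> and \<open>R E\<close> then lie in one sector.\<close>

lemma phase_window:
  assumes bound: "\<And>\<mu>. \<lbrakk>is_triple C L \<eta> R \<epsilon> E (L E) (R E) \<mu>; \<not> zero_object C (L E);
      \<not> zero_object C (R E); \<mu> \<noteq> Null C (L E) (Shift C 1 (R E))\<rbrakk> \<Longrightarrow>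
      phi_plus C A A0 ZA (L E) - phi_minus C B B0 ZB (R E) \<le> w"
    and w: "0 \<le> w" and ss: "semistable C UNIV Hgl Zgl E"
  obtains lo where
    "\<not> zero_object C (L E) \<Longrightarrow>
      lo \<le> phi_minus C A A0 ZA (L E) \<and> phi_plus C A A0 ZA (L E) \<le> lo + w"
    "\<not> zero_object C (R E) \<Longrightarrow>
      lo \<le> phi_minus C B B0 ZB (R E) \<and> phi_plus C B B0 ZB (R E) \<le> lo + w"
proof -
  have E: "E \<in> Hgl" using ss unfolding semistable_def by blast
  note c = glued_components[OF E]
  have cH: "L E \<in> Hgl" "R E \<in> Hgl" using c A0_sub B0_sub by auto
  \<comment> \<open>\<open>minus_A\<close> and \<open>plus_B\<close> come from the canonical
    triangle. \<open>plus_A\<close> and \<open>minus_B\<close> still await a triangle with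
    \<open>L E\<close> as subobject and \<open>R E\<close> as quotient, which the split case
    supplies.\<close>
  note plus_A = gl.phi_plus_le[OF A.prestable_axioms A0_sub charge_A0 ss _ c(1) cH(2)]
  note minus_A = gl.phi_minus_ge[OF A.prestable_axioms A0_sub charge_A0 ss canonical_tri cH(2) c(1)]
  note plus_B = gl.phi_plus_le[OF B.prestable_axioms B0_sub charge_B0 ss canonical_tri c(2) cH(1)]
  note minus_B = gl.phi_minus_ge[OF B.prestable_axioms B0_sub charge_B0 ss _ cH(1) c(2)]
  obtain \<mu> where \<mu>: "distinguished C (R E) E (L E) (\<epsilon> E) (\<eta> E) \<mu>" using canonical_triangle .
  then have \<mu>_mor: "\<mu> \<in> Mor C (L E) (Shift C 1 (R E))" unfolding distinguished_def by blast
  show thesis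
  proof (cases "\<mu> = Null C (L E) (Shift C 1 (R E))")
    case True
    have swap: "tri (L E) E (R E)" using tri_swap[OF \<mu> True] .
    show thesis
      \<comment> \<open>All four estimates apply, and they pin the phases of nonzero components to
        the phase of \<open>E\<close>.\<close>
      using that[of "phase C UNIV Zgl E"] plus_A[OF swap] minus_A plus_B minus_B[OF swap] w by fastforce
  next
    case False
    have nz: "\<not> zero_object C (L E)" "\<not> zero_object C (R E)"
      using False \<mu>_mor from_zero to_zero[of "Shift C 1 (R E)"] by auto
    have "phi_plus C A A0 ZA (L E) - phi_minus C B B0 ZB (R E) \<le> w"
      using bound nz False \<mu> unfolding is_triple_def by blast
    moreover have "phi_minus C A A0 ZA (L E) \<le> phi_plus C A A0 ZA (L E)"
      using A.HN_filtration_ex[OF c(1) nz(1)] by metis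
    moreover have "phi_minus C B B0 ZB (R E) \<le> phi_plus C B B0 ZB (R E)"
      using B.HN_filtration_ex[OF c(2) nz(2)] by metis
    \<comment> \<open>With \<phi> the phase of \<open>E\<close>, the chain is \<phi>^-(R E) \<le>
      \<phi>^+(R E) \<le> \<phi> \<le> \<phi>^-(L E) \<le> \<phi>^+(L E) \<le> \<phi>^-(R E) + w, so
      the window starts at \<phi>^-(R E).\<close>
    ultimately show thesis
      using that[of "phi_minus C B B0 ZB (R E)"] minus_A[OF nz(1)] plus_B[OF nz(2)] by linarith
  qed
qed

end

section \<open>The support property of the glued condition\<close>

theorem theorem1p8:
  fixes D :: "('o, 'm) tricat"
    and A B A0 B0 :: "'o set"
    and LA RB :: "'o \<Rightarrow> 'o"
    and \<eta> \<epsilon> :: "'o \<Rightarrow> 'm"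
    and ZA ZB Zgl :: "'o charge"
    and e :: real
  assumes "triangulated_category D"
    and "semiorthogonal_decomposition D A B"
    and "left_adjoint_of_inclusion D A LA \<eta>"
    and "right_adjoint_of_inclusion D B RB \<epsilon>"
    and "stability_condition D A A0 ZA"
    and "stability_condition D B B0 ZB"
    and "hearts_glue D A0 B0"
    and "is_sum_charge D A B LA RB ZA ZB Zgl"
    and "prestability_condition D UNIV (glued_heart D A0 B0) Zgl"
    and "0 < e" and "e < 1"
    and "\<forall>E a b \<mu>. semistable D UNIV (glued_heart D A0 B0) Zgl E \<longrightarrow>
           is_triple D LA \<eta> RB \<epsilon> E a b \<mu> \<longrightarrow>
           \<not> zero_object D a \<longrightarrow> \<not> zero_object D b \<longrightarrow> \<mu> \<noteq> Null D a (Shift D 1 b) \<longrightarrow>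
           phi_plus D A A0 ZA a - phi_minus D B B0 ZB b \<le> 1 - e"
  shows "stability_condition D UNIV (glued_heart D A0 B0) Zgl"
proof -
  interpret triangulated_category D by (rule assms(1))
  interpret glued D A B LA RB \<eta> \<epsilon> A0 B0 ZA ZB Zgl
    using assms by unfold_locales (auto simp: stability_condition_def)
  obtain rA uA lA NA KA where
    uA: "uA \<in> hom (K0 D A) (free_Abelian_group {..<rA::nat})"
    and lA: "lA \<in> hom (free_Abelian_group {..<rA}) complex_group"
    and ZA: "\<And>x. x \<in> carrier (K0 D A) \<Longrightarrow> ZA x = lA (uA x)"
    and NA: "is_norm rA NA" and KA: "0 < KA"
    and supA: "\<And>\<phi> E. \<lbrakk>E \<in> slice D A A0 ZA \<phi>; \<not> zero_object D E\<rbrakk> \<Longrightarrow>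
      frag_norm NA (uA (K0_class D A E)) \<le> KA * cmod (ZA (K0_class D A E))"
    using assms(5) unfolding stability_condition_def support_property_def frag_norm_def by metis
  obtain rB uB lB NB KB where
    uB: "uB \<in> hom (K0 D B) (free_Abelian_group {..<rB::nat})"
    and lB: "lB \<in> hom (free_Abelian_group {..<rB}) complex_group"
    and ZB: "\<And>x. x \<in> carrier (K0 D B) \<Longrightarrow> ZB x = lB (uB x)"
    and NB: "is_norm rB NB" and KB: "0 < KB"
    and supB: "\<And>\<phi> E. \<lbrakk>E \<in> slice D B B0 ZB \<phi>; \<not> zero_object D E\<rbrakk> \<Longrightarrow>
      frag_norm NB (uB (K0_class D B E)) \<le> KB * cmod (ZB (K0_class D B E))"
    using assms(6) unfolding stability_condition_def support_property_def frag_norm_def by metis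
  define \<phi>A where "\<phi>A X = uA (K0_class D A X)" for X
  define \<phi>B where "\<phi>B X = uB (K0_class D B X)" for X
  \<comment> \<open>The lattice is \<int>^rA \<oplus> \<int>^rB, and the class of an object consists
    of the classes of its two components.\<close>
  define \<phi> where "\<phi> X = \<phi>A (LA X) + shift_frag rA (\<phi>B (RB X))" for X
  have addA: "additive_on A \<phi>A" and addB: "additive_on B \<phi>B"
    unfolding \<phi>A_def \<phi>B_def using additive_on_frag uA uB by blast+
  have keysA: "Poly_Mapping.keys (\<phi>A X) \<subseteq> {..<rA}" if "X \<in> A" for X
    using subsetD[OF hom_carrier[OF uA] imageI[OF K0_class_carrier[OF that]]]
    unfolding \<phi>A_def by simp
  have keysB: "Poly_Mapping.keys (\<phi>B X) \<subseteq> {..<rB}" if "X \<in> B" for X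
    using subsetD[OF hom_carrier[OF uB] imageI[OF K0_class_carrier[OF that]]]
    unfolding \<phi>B_def by simp
  have add: "additive_on UNIV \<phi>"
    using additive_L[OF addA] additive_R[OF addB] unfolding \<phi>_def additive_on_def
    by (simp add: shift_frag_add algebra_simps)
  have keys: "Poly_Mapping.keys (\<phi> X) \<subseteq> {..<rA + rB}" for X
    using keysA[OF L_in, of X] keys_shift_frag[OF keysB[OF R_in, of X], of rA]
      keys_add[of "\<phi>A (LA X)" "shift_frag rA (\<phi>B (RB X))"] unfolding \<phi>_def by fastforce
  obtain u where u: "u \<in> hom (K0 D UNIV) (free_Abelian_group {..<rA + rB})"
    "\<And>X. u (K0_class D UNIV X) = \<phi> X"
    using K0_hom_exists[OF add keys] by auto
  obtain l where l: "l \<in> hom (free_Abelian_group {..<rA + rB}) complex_group"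
    "\<And>x y. \<lbrakk>Poly_Mapping.keys x \<subseteq> {..<rA}; Poly_Mapping.keys y \<subseteq> {..<rB}\<rbrakk> \<Longrightarrow>
      l (x + shift_frag rA y) = lA x + lB y"
    using sum_charge_exists[OF lA lB] by metis
  have l\<phi>: "l (\<phi> X) = gl.charge X" for X
    using l(2)[OF keysA[OF L_in] keysB[OF R_in], of X X] charge_gl[of X] ZA ZB K0_class_carrier L_in R_in
    unfolding \<phi>_def \<phi>A_def \<phi>B_def A.charge_def B.charge_def by simp
  \<comment> \<open>Both sides are homomorphisms on K_0, so agreement on classes of objects
    suffices.\<close>
  have fact: "Zgl x = l (u x)" if "x \<in> carrier (K0 D UNIV)" for x
    using K0_hom_eqI[of Zgl UNIV "l \<circ> u" x] hom_compose[OF u(1) l(1)] l\<phi> u(2) that assms(8)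
    unfolding gl.charge_def is_sum_charge_def by simp
  let ?N = "sum_norm rA NA NB"
  have N: "is_norm (rA + rB) ?N" using is_norm_sum_norm[OF NA NB] .
  have ssA: "frag_norm NA (\<phi>A F) \<le> KA * cmod (A.charge F)" if "semistable D A A0 ZA F" for F
  proof -
    \<comment> \<open>The support property is stated for slices; a semistable object of the heart
      enters its slice as a shift by 0.\<close>
    have "Shift D 0 F \<in> slice D A A0 ZA (phase D A ZA F)" using that unfolding slice_def by force
    then show ?thesis
      using supA that unfolding semistable_def \<phi>A_def A.charge_def by (simp add: shift_0)
  qed
  have ssB: "frag_norm NB (\<phi>B F) \<le> KB * cmod (B.charge F)" if "semistable D B B0 ZB F" for F
  proof -
    have "Shift D 0 F \<in> slice D B B0 ZB (phase D B ZB F)" using that unfolding slice_def by force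
    then show ?thesis
      using supB that unfolding semistable_def \<phi>B_def B.charge_def by (simp add: shift_0)
  qed
  \<comment> \<open>The constant of a sector of angle \<open>pi * (1 - e)\<close>; it is positive
    because half that angle is below \<pi>/2.\<close>
  define c where "c = cos (pi * (1 - e) / 2)"
  have "pi * (1 - e) < pi * 1" using assms(10) by (intro mult_strict_left_mono) auto
  then have c: "0 < c" unfolding c_def using assms(11)
    by (intro cos_gt_zero_pi) (auto intro: less_le_trans[of _ 0])
  define K where "K = max KA KB / c"
  have K: "0 < K" unfolding K_def using c KA by simp
  have ss: "frag_norm ?N (\<phi> E) \<le> K * cmod (gl.charge E)" if E: "semistable D UNIV Hgl Zgl E" for E
  proof -
    have comp: "LA E \<in> A0" "RB E \<in> B0" using glued_components E unfolding semistable_def by blast+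
    obtain lo where lo:
      "\<not> zero_object D (LA E) \<Longrightarrow>
        lo \<le> phi_minus D A A0 ZA (LA E) \<and> phi_plus D A A0 ZA (LA E) \<le> lo + (1 - e)"
      "\<not> zero_object D (RB E) \<Longrightarrow>
        lo \<le> phi_minus D B B0 ZB (RB E) \<and> phi_plus D B B0 ZB (RB E) \<le> lo + (1 - e)"
      using phase_window[of E "1 - e"] assms(11,12) E by (metis diff_ge_0_iff_ge less_imp_le)
    obtain n :: nat and z where z: "A.charge (LA E) = (\<Sum>k<n. z k)"
      "frag_norm NA (\<phi>A (LA E)) \<le> KA * (\<Sum>k<n. cmod (z k))"
      "\<And>k. k < n \<Longrightarrow> \<not> zero_object D (LA E) \<and>
        phi_minus D A A0 ZA (LA E) \<le> Arg (z k) / pi \<and> Arg (z k) / pi \<le> phi_plus D A A0 ZA (LA E)"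
      using A.HN_support[OF addA keysA NA ssA comp(1)] by metis
    obtain n' :: nat and z' where z': "B.charge (RB E) = (\<Sum>k<n'. z' k)"
      "frag_norm NB (\<phi>B (RB E)) \<le> KB * (\<Sum>k<n'. cmod (z' k))"
      "\<And>k. k < n' \<Longrightarrow> \<not> zero_object D (RB E) \<and>
        phi_minus D B B0 ZB (RB E) \<le> Arg (z' k) / pi \<and> Arg (z' k) / pi \<le> phi_plus D B B0 ZB (RB E)"
      using B.HN_support[OF addB keysB NB ssB comp(2)] by metis
    let ?s = "\<Sum>k<n. cmod (z k)" and ?s' = "\<Sum>k<n'. cmod (z' k)"
    let ?t = "cis (- pi * (lo + (1 - e) / 2))"
    \<comment> \<open>Both families are rotated by the bisector of the common window. The
      nonvanishing in \<open>z(3)\<close> and \<open>z'(3)\<close> makes the bounds in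
      \<open>lo\<close> available whenever there is a summand.\<close>
    have "c * ?s \<le> Re (?t * A.charge (LA E))" "c * ?s' \<le> Re (?t * B.charge (RB E))"
      unfolding c_def z(1) z'(1) using z(3) z'(3) lo assms(10,11)
      by (intro sector_sum_bound; force)+
    \<comment> \<open>The two real parts add up because the rotation \<open>?t\<close> is the same
      and the charge of \<open>E\<close> is the sum of those of its components.\<close>
    then have "c * (?s + ?s') \<le> Re (?t * gl.charge E)"
      by (simp add: charge_gl distrib_left)
    also have "\<dots> \<le> cmod (gl.charge E)"
      using complex_Re_le_cmod[of "?t * gl.charge E"] by (simp add: norm_mult)
    finally have sum: "?s + ?s' \<le> cmod (gl.charge E) / c" using c by (simp add: field_simps)
    have "frag_norm ?N (\<phi> E) = frag_norm NA (\<phi>A (LA E)) + frag_norm NB (\<phi>B (RB E))"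
      unfolding \<phi>_def using frag_norm_sum_norm keysA[OF L_in] by blast
    also have "\<dots> \<le> max KA KB * ?s + max KA KB * ?s'"
      using z(2) z'(2) by (intro add_mono; elim order_trans; intro mult_right_mono sum_nonneg) auto
    also have "\<dots> \<le> max KA KB * (cmod (gl.charge E) / c)"
      unfolding distrib_left[symmetric] using sum KA by (intro mult_left_mono) auto
    finally show ?thesis by (simp add: K_def)
  qed
  have "support_property D UNIV Hgl Zgl"
    unfolding support_property_def
  proof (intro exI conjI ballI allI impI)
    show "u \<in> hom (K0 D UNIV) (free_Abelian_group {..<rA + rB})" by (rule u(1))
    show "l \<in> hom (free_Abelian_group {..<rA + rB}) complex_group" by (rule l(1))
    show "Zgl x = l (u x)" if "x \<in> carrier (K0 D UNIV)" for x by (rule fact[OF that])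
    show "is_norm (rA + rB) ?N" by (rule N)
    show "0 < K" by (rule K)
    fix t E assume "E \<in> slice D UNIV Hgl Zgl t" "\<not> zero_object D E"
    \<comment> \<open>An object of an arbitrary slice is a shift of a semistable object of the
      heart, and shifting changes its class and its charge by at most a sign.\<close>
    then obtain F n where F: "E = Shift D n F" "semistable D UNIV Hgl Zgl F"
      unfolding slice_def by blast
    have "frag_norm ?N (\<phi> E) = frag_norm ?N (\<phi> F)" "cmod (gl.charge E) = cmod (gl.charge F)"
      using gl.additive_shift[OF add, of F n] gl.additive_shift[OF gl.additive_charge, of F n]
        frag_norm_minus[OF N keys] F(1) by auto
    then show "?N (\<lambda>k. real_of_int (Poly_Mapping.lookup (u (K0_class D UNIV E)) k))
        \<le> K * cmod (Zgl (K0_class D UNIV E))"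
      using ss[OF F(2)] u(2) unfolding frag_norm_def gl.charge_def by simp
  qed
  then show ?thesis using assms(9) unfolding stability_condition_def by blast
qed

end
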